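(* In the setting described in the context, suppose additionally that $C$ is uniformly bounded on $\partial D(0,n^{-e})$ as $n\to\infty$. Then the prefactor $E_n^0$ satisfies, uniformly for $z\in\overline{D(0,n^{-e})}$ as $n\to\infty$, $$E_n^0(z)=E(0)\left(\mathbb I+\mathcal O(n^{e-b})+\mathcal O(n^ez)\right)\quad\text{and}\quad E_n^0(z)^{-1}=\left(\mathbb I+\mathcal O(n^{e-b})+\mathcal O(n^ez)\right)E(0)^{-1}.$$ Furthermore, for any fixed $0<\rho<1$, we have uniformly for $z,w\in\overline{D(0,n^{-e}\rho)}$ as $n\to\infty$ $$E_n^0(z)^{-1}E_n^0(w)=\mathbb I+\mathcal O(n^e(z-w)).$$
   Context: Conventions. $m$ is a fixed positive integer, $\mathbb I$ is the $m\times m$ identity matrix, $n=1,2,\ldots$ is a parameter on which all functions may depend (usually not indicated). $D(0,\rho)=\{|z|<\rho\}$; overlines denote closures. For matrix-valued quantities, $X=\mathcal O(g)$ as $n\to\infty$ means $\|X\|\le M|g|$ for all sufficiently large $n$, with $M$ independent of $n$; "uniformly" means $M$ and the threshold do not depend on the indicated variables. An $\mathcal O$-term inside a product stands for some matrix-valued function with that bound. "Non-singular" means invertible everywhere. Setting. $r>0$ (with $r>1$ if $a=0$) and $a,b,c,d,e\ge0$ satisfy $a\le e<b$, $d<\min(b,c)$ and $c>b-a$. $\mathring P,N$ are $m\times m$ matrix-valued functions defined in a neighborhood of $\overline{D(0,r)}$ (no regularity imposed, $N$ invertible where inverted), and $C,E$ are $m\times m$ functions in a neighborhood of $\overline{D(0,r)}$,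 such that uniformly for $z\in\partial D(0,n^{-a})$ as $n\to\infty$ $$\mathring P(z)N(z)^{-1}E(z)=\mathbb I+\frac{C(z)}{n^bz}+\mathcal O(n^{-c}).$$ (i) $C$ is meromorphic with only a possible pole at $0$ of order at most $p$ for all $n$ ($p$ a fixed non-negative integer), and is uniformly bounded on $\partial D(0,n^{-a})$ as $n\to\infty$. (ii) $E$ is non-singular and analytic, and uniformly for $z,w\in\partial D(0,n^{-a})$ as $n\to\infty$: $E(z)=\mathcal O(n^{d/2})$, $E(z)^{-1}=\mathcal O(n^{d/2})$, $E(z)^{-1}E(w)=\mathbb I+\mathcal O(n^e(z-w))$. Prefactor $E_n^0$. For a matrix-valued function $G$ meromorphic on $\overline{D(0,r)}$ with at most a pole at $0$, $G^-$ denotes the principal part of its Laurent series at $0$ (the terms with negative powers of $z$), $G^+=G-G^-$, and $$\pi G=-G^+G-GG^-+G^+G^-+G^+GG^-.$$ $\pi^j$ is the $j$-fold iterate ($\pi^0G=G$). Put $F(z)=\dfrac{E(z)C(z)E(z)^{-1}}{n^bz}$, and let $K$ be the biggest integer such that $2^K<\frac{a+c-e}{b-e}$. Then $$E_n^0(z)=\left(\mathbb I-(\pi^KF)^+(z)\right)\left(\mathbb I-(\pi^{K-1}F)^+(z)\right)\cdots\left(\mathbb I-F^+(z)\right)E(z),\qquad z\in\overline{D(0,n^{-a})},$$ which is invertible on this disc for $n$ large enough. *)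

theory Defs
  imports "HOL-Complex_Analysis.Complex_Analysis"
begin

text \<open>
  Matrix-valued functions are functions into \<^typ>\<open>complex^'m^'m\<close>; analyticity and meromorphy are
  entrywise.  The norm is the one of \<^typ>\<open>complex^'m^'m\<close>, and \<^term>\<open>mat k\<close> is the scalar
  matrix with \<^term>\<open>k\<close> on the diagonal, so \<^term>\<open>mat k ** A\<close> is the multiple of \<^term>\<open>A\<close> by \<^term>\<open>k\<close>.
\<close>

text \<open>
  \<open>X = O(g)\<close> as \<open>n \<rightarrow> \<infinity>\<close>, uniformly for \<open>x \<in> S n\<close>: constant and threshold do not depend on \<open>x\<close>.
\<close>

definition unif_bigo ::
  "(nat \<Rightarrow> 'i set) \<Rightarrow> (nat \<Rightarrow> 'i \<Rightarrow> 'a::real_normed_vector) \<Rightarrow> (nat \<Rightarrow> 'i \<Rightarrow> 'b::real_normed_vector) \<Rightarrow> bool"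
  where "unif_bigo S X g \<longleftrightarrow>
    (\<exists>M. \<forall>\<^sub>F n in sequentially. \<forall>x\<in>S n. norm (X n x) \<le> M * norm (g n x))"

definition matrix_analytic_on :: "(complex \<Rightarrow> complex^'m::finite^'m) \<Rightarrow> complex set \<Rightarrow> bool"
  where "matrix_analytic_on G U \<longleftrightarrow> (\<forall>i j. (\<lambda>z. G z $ i $ j) analytic_on U)"

text \<open>
  Meromorphic on \<open>U\<close> with at most a pole of order \<open>p\<close> at 0 and no other pole.  The order is only
  constrained at an actual pole, since \<^const>\<open>zorder\<close> carries no information for the zero function.
  The value of \<open>G\<close> at 0 itself is irrelevant.
\<close>

definition matrix_meromorphic_pole0 ::
  "nat \<Rightarrow> (complex \<Rightarrow> complex^'m::finite^'m) \<Rightarrow> complex set \<Rightarrow> bool"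
  where "matrix_meromorphic_pole0 p G U \<longleftrightarrow>
    (\<forall>i j. (\<lambda>z. G z $ i $ j) meromorphic_on U \<and>
           (\<lambda>z. G z $ i $ j) analytic_on (U - {0}) \<and>
           (is_pole (\<lambda>z. G z $ i $ j) 0 \<longrightarrow> - int p \<le> zorder (\<lambda>z. G z $ i $ j) 0))"

text \<open>
  The principal part \<open>G\<^sup>-\<close> at 0.  \<^term>\<open>fls_prpart\<close> is the polynomial without constant term whose
  coefficient of degree \<open>k\<close> is the Laurent coefficient of \<open>z\<close> to the power \<open>-k\<close>; it is
  evaluated at \<open>1 / z\<close>.
\<close>

definition principal_part :: "(complex \<Rightarrow> complex^'m::finite^'m) \<Rightarrow> complex \<Rightarrow> complex^'m^'m"
  where "principal_part G z =
    (\<chi> i j. poly (fls_prpart (laurent_expansion (\<lambda>w. G w $ i $ j) 0)) (inverse z))"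

text \<open>
  \<open>G\<^sup>+ = G - G\<^sup>-\<close> has a removable singularity at 0, where its value is the limit.
\<close>

definition regular_part :: "(complex \<Rightarrow> complex^'m::finite^'m) \<Rightarrow> complex \<Rightarrow> complex^'m^'m"
  where "regular_part G z =
    (if z = 0 then Lim (at 0) (\<lambda>w. G w - principal_part G w) else G z - principal_part G z)"

definition pi_op :: "(complex \<Rightarrow> complex^'m::finite^'m) \<Rightarrow> complex \<Rightarrow> complex^'m^'m"
  where "pi_op G z =
    - (regular_part G z ** G z) - G z ** principal_part G z
    + regular_part G z ** principal_part G z
    + regular_part G z ** G z ** principal_part G z"

definition F_fun ::
  "real \<Rightarrow> (nat \<Rightarrow> complex \<Rightarrow> complex^'m::finite^'m) \<Rightarrow> (nat \<Rightarrow> complex \<Rightarrow> complex^'m^'m)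
    \<Rightarrow> nat \<Rightarrow> complex \<Rightarrow> complex^'m^'m"
  where "F_fun b C E n z =
    mat (1 / (of_real (real n powr b) * z)) ** (E n z ** C n z ** matrix_inv (E n z))"

text \<open>
  The conditions \<open>e < b\<close> and \<open>c > b - a\<close> make the quotient larger than 1, so the greatest such
  integer is non-negative and \<^const>\<open>nat\<close> does not truncate.
\<close>

definition K_exp :: "real \<Rightarrow> real \<Rightarrow> real \<Rightarrow> real \<Rightarrow> nat"
  where "K_exp a b c e = nat (GREATEST k::int. 2 powi k < (a + c - e) / (b - e))"

primrec pi_product :: "(complex \<Rightarrow> complex^'m::finite^'m) \<Rightarrow> nat \<Rightarrow> complex \<Rightarrow> complex^'m^'m"
  where
    "pi_product F 0 z = mat 1 - regular_part F z"
  | "pi_product F (Suc k) z = (mat 1 - regular_part ((pi_op ^^ Suc k) F) z) ** pi_product F k z"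

definition prefactor ::
  "real \<Rightarrow> real \<Rightarrow> real \<Rightarrow> real \<Rightarrow> (nat \<Rightarrow> complex \<Rightarrow> complex^'m::finite^'m)
    \<Rightarrow> (nat \<Rightarrow> complex \<Rightarrow> complex^'m^'m) \<Rightarrow> nat \<Rightarrow> complex \<Rightarrow> complex^'m^'m"
  where "prefactor a b c e C E n z = pi_product (F_fun b C E n) (K_exp a b c e) z ** E n z"

end

theory Submission
  imports Defs
begin

text \<open>
  On the disc of radius \<open>n\<^sup>-\<^sup>e\<close> the matrix \<open>E(z)\<close> is comparable to \<open>E(0)\<close>: dividing
  \<open>E(z)\<^sup>-\<^sup>1 E(w) - I\<close> by \<open>z - w\<close>, the maximum principle in each variable extends the assumed
  estimate from the circle \<open>\<bar>z\<bar> = n\<^sup>-\<^sup>a\<close> to the closed disc. Hence \<open>F\<close>, conjugated by the constant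
  matrix \<open>E(0)\<close>, is \<open>O(\<delta>)\<close> on \<open>\<bar>z\<bar> = n\<^sup>-\<^sup>e\<close> with \<open>\<delta> = n\<^bsup>e - b\<^esup>\<close>; the operator \<open>\<pi>\<close> commutes with
  this conjugation. The pole order stays bounded, so Cauchy's estimates bound a principal part on the
  circle by the function itself, and every \<open>(\<pi>\<^sup>k F)\<^sup>+\<close> is \<open>O(\<delta>)\<close> on the whole disc. The
  conjugated product of the factors is therefore \<open>I + O(\<delta>)\<close>, and so is its inverse. The last estimate
  is Cauchy's Lipschitz bound for \<open>E(0)\<^sup>-\<^sup>1 E\<^sub>n\<^sup>0\<close>, obtained by the same division argument.
\<close>

no_notation fps_nth (infixl "$" 75)

section \<open>Matrix norms and inverses\<close>

lemma norm_matrix_entry_le: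
  fixes A :: "'a::real_normed_field^'n^'m"
  shows "norm (A $ i $ j) \<le> norm A"
  using Finite_Cartesian_Product.norm_nth_le[of "A $ i" j]
    Finite_Cartesian_Product.norm_nth_le[of A i] by linarith

text \<open>The Euclidean norm is at most the sum of the norms of all entries. The factors
  \<open>real CARD('m) * real CARD('m)\<close> in the later estimates come from this passage from
  entries to matrices.\<close>

lemma norm_matrix_le_bound:
  fixes A :: "'a::real_normed_field^'n^'m"
  assumes "\<And>i j. norm (A $ i $ j) \<le> B"
  shows "norm A \<le> real CARD('m) * real CARD('n) * B"
proof -
  have "norm A \<le> (\<Sum>i\<in>UNIV. norm (A $ i))"
    unfolding norm_vec_def by (rule L2_set_le_sum) auto
  also have "\<dots> \<le> (\<Sum>i\<in>(UNIV::'m set). \<Sum>j\<in>(UNIV::'n set). norm (A $ i $ j))"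
    by (intro sum_mono) (auto simp: norm_vec_def intro!: L2_set_le_sum)
  also have "\<dots> \<le> (\<Sum>i\<in>(UNIV::'m set). \<Sum>j\<in>(UNIV::'n set). B)"
    by (intro sum_mono assms)
  finally show ?thesis
    by (simp add: mult.assoc)
qed

lemma norm_sum_mult_le_L2_set:
  fixes f g :: "'k \<Rightarrow> 'a::real_normed_field"
  shows "norm (\<Sum>k\<in>S. f k * g k) \<le> L2_set (\<lambda>k. norm (f k)) S * L2_set (\<lambda>k. norm (g k)) S"
proof -
  have "norm (\<Sum>k\<in>S. f k * g k) \<le> (\<Sum>k\<in>S. \<bar>norm (f k)\<bar> * \<bar>norm (g k)\<bar>)"
    by (rule order.trans[OF norm_sum]) (simp add: norm_mult)
  also have "\<dots> \<le> L2_set (\<lambda>k. norm (f k)) S * L2_set (\<lambda>k. norm (g k)) S"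
    by (rule L2_set_mult_ineq)
  finally show ?thesis .
qed

lemma norm_matrix_vector_mult_le:
  fixes A :: "'a::real_normed_field^'n^'m"
  shows "norm (A *v x) \<le> norm A * norm x"
proof -
  have "norm (A *v x) \<le> L2_set (\<lambda>i. norm (A $ i) * norm x) UNIV"
    unfolding norm_vec_def[of "A *v x"]
    by (intro L2_set_mono)
      (auto simp: matrix_vector_mult_def norm_vec_def[of x] norm_vec_def[of "A $ i" for i]
        intro: norm_sum_mult_le_L2_set)
  also have "\<dots> = norm A * norm x"
    by (simp add: norm_vec_def[of A] L2_set_left_distrib)
  finally show ?thesis .
qed

lemma norm_matrix_mult_le:
  fixes A :: "'a::real_normed_field^'n^'m" and B :: "'a^'k^'n"
  shows "norm (A ** B) \<le> norm A * norm B"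
proof -
  \<comment> \<open>\<open>c j\<close> is the Euclidean norm of column \<open>j\<close> of
    \<open>B\<close>. Since the matrix norm is the square root of the sum of all squared entry
    norms, it can be computed by columns as well as by rows.\<close>
  define c where "c = (\<lambda>j. L2_set (\<lambda>k. norm (B $ k $ j)) UNIV)"
  have c: "L2_set c UNIV = norm B"
    unfolding c_def norm_vec_def L2_set_def
    by (simp add: sum_nonneg) (rule sum.swap)
  have "norm (A ** B) \<le> L2_set (\<lambda>i. norm (A $ i) * norm B) UNIV"
    unfolding norm_vec_def[of "A ** B"]
  proof (intro L2_set_mono)
    fix i
    have "norm ((A ** B) $ i) \<le> L2_set (\<lambda>j. norm (A $ i) * c j) UNIV"
      unfolding norm_vec_def[of "(A ** B) $ i"]
      by (intro L2_set_mono)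
        (auto simp: matrix_matrix_mult_def c_def norm_vec_def[of "A $ i" for i]
          intro: norm_sum_mult_le_L2_set)
    also have "\<dots> = norm (A $ i) * norm B"
      by (simp add: c[symmetric] L2_set_right_distrib)
    finally show "norm ((A ** B) $ i) \<le> norm (A $ i) * norm B" .
  qed auto
  also have "\<dots> = norm A * norm B"
    by (simp add: norm_vec_def[of A] L2_set_left_distrib)
  finally show ?thesis .
qed

lemma matrix_mult_add_distribs:
  fixes A B C :: "'a::comm_ring_1^'n^'n"
  shows "A ** (B + C) = A ** B + A ** C" "(A + B) ** C = A ** C + B ** C"
    and "A ** (B - C) = A ** B - A ** C" "(A - B) ** C = A ** C - B ** C"
    and "A ** (- C) = - (A ** C)" "(- A) ** C = - (A ** C)"
  by (simp_all add: matrix_matrix_mult_def vec_eq_iff algebra_simps sum.distrib sum_subtractf sum_negf)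

lemma mat_mult_nth: 
  fixes A :: "'a::comm_ring_1^'n^'n"
  shows "(mat k ** A) $ i $ j = k * A $ i $ j"
  by (simp add: matrix_matrix_mult_def mat_def if_distrib[of "\<lambda>x. x * _"] cong: if_cong)

lemma matrix_inv_inverse:
  fixes A :: "'a::field^'n^'n"
  assumes "invertible A"
  shows "A ** matrix_inv A = mat 1" "matrix_inv A ** A = mat 1"
proof -
  have "\<exists>A'. A ** A' = mat 1 \<and> A' ** A = mat 1"
    using assms by (auto simp: invertible_def)
  from someI_ex[OF this] show "A ** matrix_inv A = mat 1" "matrix_inv A ** A = mat 1"
    by (auto simp: matrix_inv_def)
qed

lemma matrix_inv_eqI:
  fixes A B :: "'a::field^'n^'n"
  assumes "A ** B = mat 1"
  shows "invertible A" "matrix_inv A = B"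
proof -
  show inv: "invertible A"
    using assms by (auto simp: invertible_right_inverse)
  have "matrix_inv A = matrix_inv A ** (A ** B)"
    by (simp add: assms)
  also have "\<dots> = B"
    by (simp add: matrix_mul_assoc matrix_inv_inverse[OF inv])
  finally show "matrix_inv A = B" .
qed

text \<open>Cramer's rule for column \<open>l\<close> of the inverse. Writing the entries as
  quotients of determinants is what makes the inverse of an analytic matrix function
  analytic.\<close>

lemma matrix_inv_entry_det:
  fixes A :: "'a::field^'n^'n"
  assumes "invertible A"
  shows "matrix_inv A $ k $ l = det (\<chi> i j. if j = k then (if i = l then 1 else 0) else A $ i $ j) / det A"
proof -
  define x where "x = (\<chi> k. matrix_inv A $ k $ l)"
  have "A *v x = (\<chi> i. (A ** matrix_inv A) $ i $ l)"
    by (simp add: x_def matrix_vector_mult_def matrix_matrix_mult_def)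
  also have "\<dots> = (\<chi> i. if i = l then 1 else 0)"
    by (simp add: matrix_inv_inverse[OF assms] mat_def)
  finally have "x = (\<chi> k. det (\<chi> i j. if j = k then (if i = l then 1 else 0) else A $ i $ j) / det A)"
    using assms by (subst (asm) cramer) (auto simp: invertible_det_nz cong: if_cong)
  then show ?thesis
    by (simp add: x_def vec_eq_iff)
qed

text \<open>A kernel vector satisfies \<open>v = - (X *v v)\<close>, so its norm is at most half of
  itself. The inverse \<open>Z\<close> satisfies \<open>Z - mat 1 = - (X ** Z)\<close>, which first
  bounds \<open>Z\<close> by twice the norm of the identity and then bounds the difference. The norm
  of \<open>mat 1\<close> stays in the constant because it is not 1 in general.\<close>

lemma invertible_mat_1_add_small:
  fixes X :: "'a::real_normed_field^'n^'n"
  assumes X: "norm X \<le> 1 / 2"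
  shows "invertible (mat 1 + X)"
    and "norm (matrix_inv (mat 1 + X) - mat 1) \<le> 2 * norm (mat 1 :: 'a^'n^'n) * norm X"
proof -
  show inv: "invertible (mat 1 + X)"
    unfolding invertible_left_inverse matrix_left_invertible_ker
  proof (intro allI impI)
    fix v :: "'a^'n"
    assume "(mat 1 + X) *v v = 0"
    then have "v = - (X *v v)"
      by (simp add: algebra_simps add_eq_0_iff)
    then have "norm v \<le> norm X * norm v"
      using norm_matrix_vector_mult_le[of X v] by (metis norm_minus_cancel)
    also have "\<dots> \<le> 1 / 2 * norm v"
      using X by (intro mult_right_mono) auto
    finally show "v = 0"
      by simp
  qed
  define Z where "Z = matrix_inv (mat 1 + X)"
  have "Z + X ** Z = mat 1"
    using matrix_inv_inverse(1)[OF inv] by (simp add: Z_def matrix_mult_add_distribs)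
  then have Z: "Z - mat 1 = - (X ** Z)"
    by (metis add_diff_cancel_left' minus_diff_eq)
  have XZ: "norm (Z - mat 1) \<le> norm X * norm Z"
    using norm_matrix_mult_le[of X Z] unfolding Z by simp
  have "norm Z \<le> norm (mat 1 :: 'a^'n^'n) + norm (Z - mat 1)"
    by (metis add.commute diff_add_cancel norm_triangle_ineq)
  also have "norm (Z - mat 1) \<le> 1 / 2 * norm Z"
    using XZ X by (meson mult_right_mono norm_ge_zero order.trans)
  finally have "norm Z \<le> 2 * norm (mat 1 :: 'a^'n^'n)"
    by simp
  then have "norm X * norm Z \<le> norm X * (2 * norm (mat 1 :: 'a^'n^'n))"
    by (intro mult_left_mono) auto
  with XZ show "norm (Z - mat 1) \<le> 2 * norm (mat 1 :: 'a^'n^'n) * norm X"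
    by (simp add: mult_ac)
qed

section \<open>Scalar functions with a pole at 0\<close>

lemma analytic_le_on_cball:
  fixes f :: "complex \<Rightarrow> complex"
  assumes f: "f analytic_on U" and U: "cball 0 R \<subseteq> U"
    and B: "\<And>z. z \<in> sphere 0 R \<Longrightarrow> norm (f z) \<le> B" and z: "z \<in> cball 0 R"
  shows "norm (f z) \<le> B"
proof (rule maximum_modulus_frontier[of f "cball 0 R"])
  have hol: "f holomorphic_on cball 0 R"
    using f U analytic_imp_holomorphic analytic_on_subset by blast
  then show "f holomorphic_on interior (cball 0 R)"
    by (rule holomorphic_on_subset) (rule interior_subset)
  show "continuous_on (closure (cball 0 R)) f"
    using hol by (simp add: holomorphic_on_imp_continuous_on)
qed (use z B in auto)

text \<open>
  The maximum principle for \<open>f z / (z - w)\<close>; if \<open>w\<close> lies on the circle, the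
  bound on the quotient there extends to \<open>w\<close> by continuity.
\<close>

lemma analytic_le_linear_on_cball:
  fixes f :: "complex \<Rightarrow> complex"
  assumes f: "f analytic_on U" and "open U" and U: "cball 0 R \<subseteq> U"
    and w: "w \<in> cball 0 R" "f w = 0"
    and B: "\<And>z. z \<in> sphere 0 R \<Longrightarrow> norm (f z) \<le> B * norm (z - w)" and z: "z \<in> cball 0 R"
  shows "norm (f z) \<le> B * norm (z - w)"
proof (cases "R > 0")
  \<comment> \<open>The disc has shrunk to a single point, which lies on its own circle.\<close>
  case False
  moreover have "norm z \<le> R"
    using z by simp
  ultimately have "norm z = R"
    using norm_ge_zero[of z] by linarith
  then show ?thesis by (simp add: B)
next
  case True
  \<comment> \<open>The difference quotient, completed by the derivative at \<open>w\<close>, is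
    holomorphic there too.\<close>
  define g where "g = (\<lambda>z. if z = w then deriv f w else (f z - f w) / (z - w))"
  have g: "g holomorphic_on U"
    unfolding g_def using f \<open>open U\<close> by (intro pole_lemma_open) (auto simp: analytic_on_open)
  have gB: "norm (g z) \<le> B" if "z \<in> sphere 0 R - {w}" for z
    using B[of z] that w by (auto simp: g_def norm_divide field_simps)
  have "norm (g z) \<le> B" if z: "z \<in> sphere 0 R" for z
  proof (cases "z = w")
    case False
    with z gB show ?thesis by auto
  next
    case wz: True
    \<comment> \<open>A connected set with at least two points has no isolated point; here the
      points \<open>R\<close> and \<open>-R\<close> are distinct.\<close>
    have "z islimpt sphere 0 R"
    proof (rule connected_imp_perfect)
      show "connected (sphere (0::complex) R)"
        by (rule connected_sphere) simp
      show "sphere 0 R \<noteq> {x}" for x :: complex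
      proof
        assume *: "sphere 0 R = {x}"
        have "of_real R \<in> sphere (0::complex) R" "- of_real R \<in> sphere (0::complex) R"
          using True by auto
        then have "of_real R = x" "- of_real R = x"
          unfolding * by blast+
        then have "(of_real R :: complex) = - of_real R"
          by simp
        with True show False
          by (simp add: complex_eq_iff)
      qed
    qed fact
    then have z': "z \<in> closure (sphere 0 R - {w})"
      unfolding islimpt_in_closure wz .
    have sub: "closure (sphere 0 R - {w}) \<subseteq> sphere 0 R"
      by (intro closure_minimal) auto
    have "closure (sphere 0 R - {w}) \<subseteq> U"
      using sub sphere_cball U by (meson order.trans)
    then have "continuous_on (closure (sphere 0 R - {w})) (\<lambda>z. norm (g z))"
      by (rule continuous_on_norm[OF holomorphic_on_imp_continuous_on[OF holomorphic_on_subset[OF g]]])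
    from continuous_le_on_closure[OF this z' gB] show ?thesis .
  qed
  then have "norm (g z) \<le> B"
    using g \<open>open U\<close> U z by (intro analytic_le_on_cball[of g U R B z]) (auto simp: analytic_on_open)
  then show ?thesis
    using w by (cases "z = w") (auto simp: g_def norm_divide field_simps)
qed

section \<open>Laurent expansion of a quotient \<open>h z / z ^ q\<close>\<close>

context
  fixes f h :: "complex \<Rightarrow> complex" and U :: "complex set" and q :: nat
  assumes h: "h analytic_on U" and U: "open U" "0 \<in> U"
    and f: "\<And>z. z \<in> U - {0} \<Longrightarrow> f z = h z / z ^ q"
begin

lemma pole_has_laurent_expansion:
  "f has_laurent_expansion fls_shift (int q) (fps_to_fls (fps_expansion h 0))"
proof -
  have "h has_fps_expansion fps_expansion h 0"
    using h U by (intro analytic_at_imp_has_fps_expansion_0) (auto intro: analytic_on_subset)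
  then have "(\<lambda>z. h z * z powi (- int q)) has_laurent_expansion
      fls_shift (int q) (fps_to_fls (fps_expansion h 0))"
    by (intro laurent_expansion_intros has_laurent_expansion_fps)
  also have "?this \<longleftrightarrow> ?thesis"
  proof (intro has_laurent_expansion_cong refl)
    have "eventually (\<lambda>z. z \<in> U - {0}) (at 0)"
      using U by (intro eventually_at_in_open)
    then show "eventually (\<lambda>z. h z * z powi (- int q) = f z) (at 0)"
      by eventually_elim (auto simp: f power_int_minus field_simps)
  qed
  finally show ?thesis .
qed

text \<open>Dividing by \<open>z ^ q\<close> shifts the Taylor series of \<open>h\<close>, so the
  coefficient of the power \<open>-k\<close> is the Taylor coefficient of index
  \<open>q - k\<close>. It belongs to the principal part exactly for \<open>k\<close> from 1 to
  \<open>q\<close>.\<close>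

lemma poly_fls_prpart_pole:
  "poly (fls_prpart (laurent_expansion f 0)) x
     = (\<Sum>k=1..q. fps_nth (fps_expansion h 0) (q - k) * x ^ k)"
proof -
  define c where "c = fps_nth (fps_expansion h 0)"
  have "fls_prpart (laurent_expansion f 0) = (\<Sum>k=1..q. monom (c (q - k)) k)"
    by (intro poly_eqI)
      (auto simp: laurent_expansion_0_eqI[OF pole_has_laurent_expansion] coeff_sum c_def 
        nat_diff_distrib fps_to_fls_nth of_nat_diff intro!: arg_cong[of _ _ "fps_nth _"])
  then show ?thesis
    by (simp add: poly_sum poly_monom c_def)
qed

text \<open>On the circle \<open>h\<close> is bounded by \<open>M * R ^ q\<close>. Cauchy's
  inequality for its coefficient of index \<open>q - k\<close> then bounds each of the
  \<open>q\<close> terms by \<open>M\<close>. All powers of \<open>R\<close> cancel, so the estimate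
  is not spoiled when the circle shrinks with \<open>n\<close>.\<close>

lemma norm_principal_part_le:
  assumes R: "R > 0" "cball 0 R \<subseteq> U" and M: "\<And>z. z \<in> sphere 0 R \<Longrightarrow> norm (f z) \<le> M"
    and x: "norm x = R"
  shows "norm (poly (fls_prpart (laurent_expansion f 0)) (inverse x)) \<le> real q * M"
proof -
  have hol: "h holomorphic_on cball 0 R"
    using h R analytic_imp_holomorphic analytic_on_subset by blast
  have "norm (fps_nth (fps_expansion h 0) (q - k) * inverse x ^ k) \<le> M" if k: "k \<in> {1..q}" for k
  proof -
    have "norm ((deriv ^^ (q - k)) h 0) \<le> fact (q - k) * (M * R ^ q) / R ^ (q - k)"
    proof (rule Cauchy_inequality)
      show "norm (h z) \<le> M * R ^ q" if "norm (0 - z) = R" for z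
      proof -
        have z: "z \<in> sphere 0 R" "z \<in> U - {0}"
          using that R by auto
        then show ?thesis
          using M[OF z(1)] R by (simp add: f norm_divide norm_power field_simps)
      qed
    qed (use hol R in \<open>auto intro: holomorphic_on_subset holomorphic_on_imp_continuous_on\<close>)
    also have "\<dots> = fact (q - k) * M * R ^ k"
      using k R by (simp add: power_diff)
    finally show ?thesis
      using x R by (simp add: fps_expansion_def norm_mult norm_divide norm_power norm_inverse field_simps)
  qed
  then have "norm (\<Sum>k=1..q. fps_nth (fps_expansion h 0) (q - k) * inverse x ^ k) \<le> (\<Sum>k=1..q. M)"
    by (intro sum_norm_le)
  then show ?thesis
    by (simp add: poly_fls_prpart_pole)
qed

text \<open>Subtracting the principal part cancels every negative Laurent coefficient. The
  difference therefore has a limit at 0, and the singularity is removable.\<close>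

lemma regular_part_extends:
  "\<exists>g. g analytic_on U \<and>
     (\<forall>z\<in>U - {0}. f z - poly (fls_prpart (laurent_expansion f 0)) (inverse z) = g z)"
proof -
  define c where "c = fps_nth (fps_expansion h 0)"
  define F where "F = fls_shift (int q) (fps_to_fls (fps_expansion h 0))"
  define G where "G = (\<Sum>k=1..q. fls_const (c (q - k)) * fls_X_intpow (- int k))"
  let ?P = "\<lambda>z. poly (fls_prpart (laurent_expansion f 0)) (inverse z)"
  have P: "?P z = (\<Sum>k=1..q. c (q - k) * z powi (- int k))" for z
    by (simp add: poly_fls_prpart_pole c_def power_int_minus power_inverse)
  have "(\<lambda>z. f z - (\<Sum>k=1..q. c (q - k) * z powi (- int k))) has_laurent_expansion F - G"
    unfolding F_def G_def by (intro laurent_expansion_intros pole_has_laurent_expansion)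
  then have L: "(\<lambda>z. f z - ?P z) has_laurent_expansion F - G"
    by (simp add: P)
  \<comment> \<open>\<open>G\<close> is the principal part written as a Laurent series, so it
    matches \<open>F\<close> in every negative degree.\<close>
  have "fls_prpart (F - G) = 0"
  proof (rule poly_eqI)
    fix n
    have "fls_nth F (- int n) = fls_nth G (- int n)" if n: "n > 0"
    proof -
      have "fls_nth G (- int n) = (\<Sum>k=1..q. if k = n then c (q - k) else 0)"
        unfolding G_def fls_nth_sum by (intro sum.cong refl) auto
      then show ?thesis
        using n by (auto simp: F_def c_def nat_diff_distrib intro!: arg_cong[of _ _ "fps_nth _"])
    qed
    then show "coeff (fls_prpart (F - G)) n = coeff 0 n"
      by simp
  qed
  then have "fls_subdegree (F - G) \<ge> 0"
    by (simp only: fls_prpart_eq0_iff)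
  from has_laurent_expansion_imp_tendsto_0[OF L this]
  have lim: "(\<lambda>z. f z - ?P z) \<midarrow>0\<rightarrow> fls_nth (F - G) 0" .
  have "(\<lambda>z. f z - ?P z) holomorphic_on U - {0}"
  proof -
    have "(\<lambda>z. h z / z ^ q - (\<Sum>k=1..q. c (q - k) * z powi (- int k))) holomorphic_on U - {0}"
      using h by (intro holomorphic_intros)
        (auto intro: holomorphic_on_subset analytic_imp_holomorphic)
    then show ?thesis
      by (rule holomorphic_transform) (simp add: f P)
  qed
  from removable_singularity[OF this U(1) lim] U show ?thesis
    by (intro exI[of _ "\<lambda>z. if z = 0 then fls_nth (F - G) 0 else f z - ?P z"])
      (simp add: analytic_on_open)
qed

end

text \<open>The function \<open>z ^ p * f z\<close> has a limit at 0, and filling in this value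
  gives \<open>h\<close>. Without a pole \<open>f\<close> itself converges; at a pole of order
  \<open>k\<close> one has \<open>k \<le> p\<close>, and the surplus factor
  \<open>w ^ (p - k)\<close> is harmless.\<close>

lemma meromorphic_bounded_pole_order:
  fixes f :: "complex \<Rightarrow> complex"
  assumes mero: "f meromorphic_on U" and f: "f analytic_on (U - {0})"
    and U: "open U" "0 \<in> U"
    and ord: "is_pole f 0 \<Longrightarrow> - int p \<le> zorder f 0"
  shows "\<exists>h. h analytic_on U \<and> (\<forall>z\<in>U - {0}. f z = h z / z ^ p)"
proof -
  have "\<exists>L. (\<lambda>z. z ^ p * f z) \<midarrow>0\<rightarrow> L"
  proof (cases "is_pole f 0")
    case False
    moreover have "not_essential f 0"
      using mero U(2) by (auto simp: meromorphic_on_altdef)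
    ultimately obtain L where "f \<midarrow>0\<rightarrow> L"
      by (auto simp: not_essential_def)
    then have "(\<lambda>z. z ^ p * f z) \<midarrow>0\<rightarrow> 0 ^ p * L"
      by (intro tendsto_intros)
    then show ?thesis ..
  next
    case True
    define k where "k = nat (- zorder f 0)"
    from zorder_exist_pole[OF analytic_imp_holomorphic[OF f] U True] obtain r
      where r: "r > 0" "zor_poly f 0 holomorphic_on cball 0 r" "zorder f 0 < 0"
        "\<And>w. w \<in> cball 0 r - {0} \<Longrightarrow> f w = zor_poly f 0 w / w ^ k"
      by (auto simp: k_def)
    have k: "k \<le> p"
      using ord[OF True] r(3) by (auto simp: k_def)
    have "continuous_on (cball 0 r) (zor_poly f 0)"
      using r by (intro holomorphic_on_imp_continuous_on)
    then have "isCont (zor_poly f 0) 0"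
      using r by (intro continuous_on_interior[of "cball 0 r"]) auto
    then have "(\<lambda>w. w ^ (p - k) * zor_poly f 0 w) \<midarrow>0\<rightarrow> 0 ^ (p - k) * zor_poly f 0 0"
      by (intro tendsto_intros) (simp add: isCont_def)
    moreover have "eventually (\<lambda>w. w \<in> ball 0 r - {0}) (at (0::complex))"
      using r by (intro eventually_at_in_open) auto
    then have "eventually (\<lambda>w. w ^ (p - k) * zor_poly f 0 w = w ^ p * f w) (at 0)"
      by eventually_elim (use k in \<open>auto simp: r power_diff field_simps\<close>)
    ultimately show ?thesis
      by (blast intro: Lim_transform_eventually)
  qed
  then obtain L where L: "(\<lambda>z. z ^ p * f z) \<midarrow>0\<rightarrow> L" ..
  have "(\<lambda>z. z ^ p * f z) holomorphic_on U - {0}"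
    using f by (intro holomorphic_intros analytic_imp_holomorphic)
  from removable_singularity[OF this U(1) L] U show ?thesis
    by (intro exI[of _ "\<lambda>z. if z = 0 then L else z ^ p * f z"]) (auto simp: analytic_on_open)
qed

section \<open>Matrix functions with a pole at 0\<close>

text \<open>Here \<open>q\<close> is an upper bound for the pole order, not the order itself:
  \<open>H\<close> may vanish at 0. This keeps the class closed under sums and lets the bounds add
  under products. The value of \<open>G\<close> at 0 is left free.\<close>

definition matrix_pole :: "nat \<Rightarrow> (complex \<Rightarrow> complex^'m::finite^'m) \<Rightarrow> complex set \<Rightarrow> bool"
  where "matrix_pole q G U \<longleftrightarrow>
    (\<exists>H. matrix_analytic_on H U \<and> (\<forall>z\<in>U - {0}. G z = mat (1 / z ^ q) ** H z))"

lemma mat_mult_commute: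
  fixes A :: "'a::comm_ring_1^'n^'n"
  shows "A ** mat k = mat k ** A"
  by (simp add: matrix_matrix_mult_def mat_def vec_eq_iff if_distrib[of "\<lambda>x. x * _"]
      if_distrib[of "\<lambda>x. _ * x"] mult.commute cong: if_cong)

lemma mat_mult_mult:
  fixes A B :: "'a::comm_ring_1^'n^'n"
  shows "(mat k ** A) ** (mat l ** B) = mat (k * l) ** (A ** B)"
proof -
  have "(mat k ** A) ** (mat l ** B) = mat k ** (A ** mat l) ** B"
    by (simp only: matrix_mul_assoc)
  also have "A ** mat l = mat l ** A"
    by (rule mat_mult_commute)
  also have "mat k ** (mat l ** A) ** B = (mat k ** mat l) ** (A ** B)"
    by (simp only: matrix_mul_assoc)
  also have "mat k ** mat l = (mat (k * l) :: 'a^'n^'n)"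
    by (simp add: vec_eq_iff mat_mult_nth) (simp add: mat_def)
  finally show ?thesis .
qed

lemma matrix_analytic_on_const [simp]: "matrix_analytic_on (\<lambda>z. A) U"
  by (simp add: matrix_analytic_on_def)

lemma matrix_analytic_on_mult:
  assumes "matrix_analytic_on G U" "matrix_analytic_on H U"
  shows "matrix_analytic_on (\<lambda>z. G z ** H z) U"
  using assms unfolding matrix_analytic_on_def
  by (auto simp: matrix_matrix_mult_def intro!: analytic_intros)

lemma matrix_analytic_on_mat_mult:
  assumes "matrix_analytic_on H U" "f analytic_on U"
  shows "matrix_analytic_on (\<lambda>z. mat (f z) ** H z) U"
  using assms unfolding matrix_analytic_on_def
  by (auto simp: mat_mult_nth intro!: analytic_intros)

lemma matrix_analytic_on_add:
  assumes "matrix_analytic_on G U" "matrix_analytic_on H U"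
  shows "matrix_analytic_on (\<lambda>z. G z + H z) U"
  using assms unfolding matrix_analytic_on_def by (auto intro!: analytic_intros)

lemma matrix_analytic_on_diff:
  assumes "matrix_analytic_on G U" "matrix_analytic_on H U"
  shows "matrix_analytic_on (\<lambda>z. G z - H z) U"
  using assms unfolding matrix_analytic_on_def by (auto intro!: analytic_intros)

lemma analytic_on_det:
  fixes G :: "complex \<Rightarrow> complex^'m::finite^'m"
  assumes "\<And>i j. (\<lambda>z. G z $ i $ j) analytic_on U"
  shows "(\<lambda>z. det (G z)) analytic_on U"
  unfolding det_def using assms by (intro analytic_intros) auto

lemma matrix_analytic_on_matrix_inv:
  assumes "matrix_analytic_on G U" and inv: "\<And>z. z \<in> U \<Longrightarrow> invertible (G z)"
    and "open U"
  shows "matrix_analytic_on (\<lambda>z. matrix_inv (G z)) U"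
  unfolding matrix_analytic_on_def
proof (intro allI)
  fix k l
  have G: "(\<lambda>z. G z $ i $ j) analytic_on U" for i j
    using assms(1) by (simp add: matrix_analytic_on_def)
  then have "(\<lambda>z. if j = k then (if i = l then 1 else 0) else G z $ i $ j) analytic_on U" for i j
    by (cases "j = k") simp_all
  then have "(\<lambda>z. det (\<chi> i j. if j = k then (if i = l then 1 else 0) else G z $ i $ j) / det (G z))
      analytic_on U"
    using G inv by (intro analytic_on_divide analytic_on_det) (auto simp: invertible_det_nz)
  then have "(\<lambda>z. det (\<chi> i j. if j = k then (if i = l then 1 else 0) else G z $ i $ j) / det (G z))
      holomorphic_on U"
    by (rule analytic_imp_holomorphic)
  then have "(\<lambda>z. matrix_inv (G z) $ k $ l) holomorphic_on U"
    by (rule holomorphic_transform) (simp add: matrix_inv_entry_det inv)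
  then show "(\<lambda>z. matrix_inv (G z) $ k $ l) analytic_on U"
    by (simp add: analytic_on_open \<open>open U\<close>)
qed

lemma matrix_analytic_on_transform:
  assumes "matrix_analytic_on G U" "\<And>z. z \<in> U \<Longrightarrow> G z = H z" "open U"
  shows "matrix_analytic_on H U"
  unfolding matrix_analytic_on_def
proof (intro allI)
  fix i j
  have "(\<lambda>z. G z $ i $ j) holomorphic_on U"
    using assms(1) by (auto simp: matrix_analytic_on_def intro: analytic_imp_holomorphic)
  then have "(\<lambda>z. H z $ i $ j) holomorphic_on U"
    by (rule holomorphic_transform) (simp add: assms(2))
  then show "(\<lambda>z. H z $ i $ j) analytic_on U"
    by (simp add: analytic_on_open assms(3))
qed

text \<open>The maximum principle is applied to each entry separately, which costs the number of
  entries as a factor.\<close>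

lemma matrix_analytic_le_on_cball:
  fixes A :: "complex \<Rightarrow> complex^'m::finite^'m"
  assumes "matrix_analytic_on A U" "cball 0 R \<subseteq> U"
    and "\<And>z. z \<in> sphere 0 R \<Longrightarrow> norm (A z) \<le> B" and "z \<in> cball 0 R"
  shows "norm (A z) \<le> real CARD('m) * real CARD('m) * B"
proof (rule norm_matrix_le_bound)
  fix i j
  show "norm (A z $ i $ j) \<le> B"
    using assms by (intro analytic_le_on_cball[of "\<lambda>z. A z $ i $ j" U R B z])
      (auto simp: matrix_analytic_on_def intro: order.trans[OF norm_matrix_entry_le])
qed

lemma matrix_analytic_le_linear_on_cball:
  fixes A :: "complex \<Rightarrow> complex^'m::finite^'m"
  assumes "matrix_analytic_on A U" "open U" "cball 0 R \<subseteq> U"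
    and "w \<in> cball 0 R" "A w = 0"
    and "\<And>z. z \<in> sphere 0 R \<Longrightarrow> norm (A z) \<le> B * norm (z - w)" and "z \<in> cball 0 R"
  shows "norm (A z) \<le> real CARD('m) * real CARD('m) * (B * norm (z - w))"
proof (rule norm_matrix_le_bound)
  fix i j
  show "norm (A z $ i $ j) \<le> B * norm (z - w)"
    using assms by (intro analytic_le_linear_on_cball[of "\<lambda>z. A z $ i $ j" U R w B z])
      (auto simp: matrix_analytic_on_def intro: order.trans[OF norm_matrix_entry_le])
qed

lemma matrix_pole_0: "matrix_analytic_on G U \<Longrightarrow> matrix_pole 0 G U"
  unfolding matrix_pole_def by (rule exI[of _ G]) simp

lemma matrix_pole_mono:
  assumes "matrix_pole q G U" "q \<le> q'"
  shows "matrix_pole q' G U"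
proof -
  from assms(1) obtain H where H: "matrix_analytic_on H U"
    "\<And>z. z \<in> U - {0} \<Longrightarrow> G z = mat (1 / z ^ q) ** H z"
    by (auto simp: matrix_pole_def)
  show ?thesis
    unfolding matrix_pole_def
  proof (intro exI conjI ballI)
    show "matrix_analytic_on (\<lambda>z. mat (z ^ (q' - q)) ** H z) U"
      by (intro matrix_analytic_on_mat_mult H analytic_intros)
    show "G z = mat (1 / z ^ q') ** (mat (z ^ (q' - q)) ** H z)" if "z \<in> U - {0}" for z
      using that assms(2) by (simp add: H vec_eq_iff mat_mult_nth power_diff)
  qed
qed

lemma matrix_pole_mult:
  assumes "matrix_pole p G U" "matrix_pole q H U"
  shows "matrix_pole (p + q) (\<lambda>z. G z ** H z) U"
proof -
  from assms obtain G' H' where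
    "matrix_analytic_on G' U" "\<And>z. z \<in> U - {0} \<Longrightarrow> G z = mat (1 / z ^ p) ** G' z"
    "matrix_analytic_on H' U" "\<And>z. z \<in> U - {0} \<Longrightarrow> H z = mat (1 / z ^ q) ** H' z"
    by (auto simp: matrix_pole_def)
  then show ?thesis
    unfolding matrix_pole_def
    by (intro exI[of _ "\<lambda>z. G' z ** H' z"])
      (auto simp: mat_mult_mult power_add intro: matrix_analytic_on_mult)
qed

lemma matrix_pole_add:
  assumes "matrix_pole q G U" "matrix_pole q H U"
  shows "matrix_pole q (\<lambda>z. G z + H z) U"
proof -
  from assms obtain G' H' where
    "matrix_analytic_on G' U" "\<And>z. z \<in> U - {0} \<Longrightarrow> G z = mat (1 / z ^ q) ** G' z"
    "matrix_analytic_on H' U" "\<And>z. z \<in> U - {0} \<Longrightarrow> H z = mat (1 / z ^ q) ** H' z"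
    by (auto simp: matrix_pole_def)
  then show ?thesis
    unfolding matrix_pole_def
    by (intro exI[of _ "\<lambda>z. G' z + H' z"])
      (auto simp: matrix_mult_add_distribs intro: matrix_analytic_on_add)
qed

lemma matrix_pole_uminus:
  assumes "matrix_pole q G U"
  shows "matrix_pole q (\<lambda>z. - G z) U"
proof -
  have "matrix_pole (0 + q) (\<lambda>z. mat (- 1) ** G z) U"
    by (intro matrix_pole_mult assms matrix_pole_0 matrix_analytic_on_const)
  moreover have "mat (- 1) ** A = - A" for A :: "complex^'a^'a"
    by (simp add: vec_eq_iff mat_mult_nth)
  ultimately show ?thesis by simp
qed

lemma matrix_pole_transform:
  assumes "matrix_pole q G U" "\<And>z. z \<in> U - {0} \<Longrightarrow> G z = H z"
  shows "matrix_pole q H U"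
  using assms unfolding matrix_pole_def by auto

section \<open>Principal parts, regular parts and the operator pi for matrices\<close>

lemma principal_part_nth:
  "principal_part G z $ i $ j
     = poly (fls_prpart (laurent_expansion (\<lambda>w. G w $ i $ j) 0)) (inverse z)"
  by (simp add: principal_part_def)

context
  fixes U :: "complex set"
  assumes U: "open U" "0 \<in> U"
begin

text \<open>The scalar extensions of the entries are assembled into a matrix function
  \<open>A\<close>. Its continuity at 0 identifies \<open>A 0\<close> with the limit that defines
  the regular part there.\<close>

lemma regular_part_tendsto_analytic:
  assumes "matrix_pole q G U"
  shows "matrix_analytic_on (regular_part G) U"
    and "(\<lambda>w. G w - principal_part G w) \<midarrow>0\<rightarrow> regular_part G 0"
proof -
  from assms obtain H where H: "matrix_analytic_on H U"
    "\<And>z. z \<in> U - {0} \<Longrightarrow> G z = mat (1 / z ^ q) ** H z"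
    by (auto simp: matrix_pole_def)
  have "\<exists>g. g analytic_on U \<and> (\<forall>z\<in>U - {0}. G z $ i $ j - principal_part G z $ i $ j = g z)" for i j
    unfolding principal_part_nth
    by (rule regular_part_extends[of "\<lambda>z. H z $ i $ j" _ _ q])
      (use H U in \<open>auto simp: matrix_analytic_on_def mat_mult_nth\<close>)
  then obtain g where g: "\<And>i j. g i j analytic_on U"
    "\<And>i j z. z \<in> U - {0} \<Longrightarrow> G z $ i $ j - principal_part G z $ i $ j = g i j z"
    by metis
  define A where "A = (\<lambda>z. \<chi> i j. g i j z)"
  have A: "matrix_analytic_on A U"
    by (simp add: matrix_analytic_on_def A_def g)
  have GA: "G z - principal_part G z = A z" if "z \<in> U - {0}" for z
    using g(2)[OF that] by (simp add: vec_eq_iff A_def)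
  have "A \<midarrow>0\<rightarrow> A 0"
  proof (intro vec_tendstoI)
    fix i j
    have "isCont (g i j) 0"
      using g(1)[of i j] U by (meson analytic_at_imp_isCont analytic_on_analytic_at)
    then show "(\<lambda>z. A z $ i $ j) \<midarrow>0\<rightarrow> A 0 $ i $ j"
      by (simp add: A_def isCont_def)
  qed
  moreover have "eventually (\<lambda>z. z \<in> U - {0}) (at 0)"
    using U by (intro eventually_at_in_open)
  then have "eventually (\<lambda>z. A z = G z - principal_part G z) (at 0)"
    by eventually_elim (simp add: GA)
  ultimately have lim: "(\<lambda>w. G w - principal_part G w) \<midarrow>0\<rightarrow> A 0"
    by (rule Lim_transform_eventually)
  then have A0: "regular_part G 0 = A 0"
    by (simp add: regular_part_def tendsto_Lim)
  with lim show "(\<lambda>w. G w - principal_part G w) \<midarrow>0\<rightarrow> regular_part G 0"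
    by simp
  show "matrix_analytic_on (regular_part G) U"
  proof (rule matrix_analytic_on_transform[OF A])
    show "A z = regular_part G z" if "z \<in> U" for z
      using that A0 GA[of z] by (cases "z = 0") (auto simp: regular_part_def)
  qed (rule U)
qed

lemma matrix_pole_principal_part:
  assumes "matrix_pole q G U"
  shows "matrix_pole q (principal_part G) U"
proof -
  have "matrix_pole q (regular_part G) U"
    by (rule matrix_pole_mono[OF matrix_pole_0[OF regular_part_tendsto_analytic(1)[OF assms]]]) simp
  then have "matrix_pole q (\<lambda>z. G z + - regular_part G z) U"
    by (intro matrix_pole_add matrix_pole_uminus assms)
  then show ?thesis
    by (rule matrix_pole_transform) (simp add: regular_part_def)
qed

text \<open>Regular factors contribute no pole, and each of the four terms has at most the two
  singular factors \<open>G\<close> and its principal part. Hence the bound on the order at most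
  doubles.\<close>

lemma matrix_pole_pi_op:
  assumes "matrix_pole q G U"
  shows "matrix_pole (2 * q) (pi_op G) U"
proof -
  note reg = matrix_pole_0[OF regular_part_tendsto_analytic(1)[OF assms]]
  note prin = matrix_pole_principal_part[OF assms]
  have "matrix_pole (2 * q) (\<lambda>z. - (regular_part G z ** G z) + - (G z ** principal_part G z)
      + regular_part G z ** principal_part G z
      + regular_part G z ** G z ** principal_part G z) U"
    by (intro matrix_pole_add matrix_pole_uminus)
      (rule matrix_pole_mono, (rule matrix_pole_mult reg prin assms)+, simp)+
  then show ?thesis
    by (simp add: pi_op_def[abs_def])
qed

lemma matrix_pole_pi_op_funpow:
  assumes "matrix_pole q G U"
  shows "matrix_pole (2 ^ k * q) ((pi_op ^^ k) G) U"
proof (induction k)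
  case (Suc k)
  from matrix_pole_pi_op[OF this] show ?case by (simp add: mult.assoc)
qed (simp add: assms)

lemma matrix_pole_has_laurent_expansion:
  assumes "matrix_pole q G U"
  shows "(\<lambda>w. G w $ i $ j) has_laurent_expansion laurent_expansion (\<lambda>w. G w $ i $ j) 0"
proof -
  from assms obtain H where H: "matrix_analytic_on H U"
    "\<And>z. z \<in> U - {0} \<Longrightarrow> G z = mat (1 / z ^ q) ** H z"
    by (auto simp: matrix_pole_def)
  have "(\<lambda>w. G w $ i $ j) has_laurent_expansion
      fls_shift (int q) (fps_to_fls (fps_expansion (\<lambda>w. H w $ i $ j) 0))"
    by (rule pole_has_laurent_expansion[of "\<lambda>z. H z $ i $ j" U])
      (use H U in \<open>auto simp: matrix_analytic_on_def mat_mult_nth\<close>)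
  then show ?thesis
    using laurent_expansion_0_eqI by fastforce
qed

text \<open>Constant matrices act linearly on the Laurent coefficients and do not mix different
  powers of \<open>z\<close>.\<close>

lemma principal_part_mult_const:
  fixes B C :: "complex^'m::finite^'m"
  assumes "matrix_pole q G U"
  shows "principal_part (\<lambda>z. B ** G z ** C) z = B ** principal_part G z ** C"
proof -
  define L where "L = (\<lambda>i j. laurent_expansion (\<lambda>w. G w $ i $ j) 0)"
  have L: "(\<lambda>w. G w $ i $ j) has_laurent_expansion L i j" for i j
    unfolding L_def by (rule matrix_pole_has_laurent_expansion[OF assms])
  have "poly (fls_prpart (laurent_expansion (\<lambda>w. (B ** G w ** C) $ i $ j) 0)) x
      = (\<Sum>l\<in>UNIV. (\<Sum>k\<in>UNIV. B $ i $ k * poly (fls_prpart (L k l)) x) * C $ l $ j)" for i j x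
  proof -
    have "(\<lambda>w. \<Sum>l\<in>UNIV. (\<Sum>k\<in>UNIV. B $ i $ k * G w $ k $ l) * C $ l $ j) has_laurent_expansion
        (\<Sum>l\<in>UNIV. (\<Sum>k\<in>UNIV. fls_const (B $ i $ k) * L k l) * fls_const (C $ l $ j))"
      by (intro laurent_expansion_intros L)
    then have "laurent_expansion (\<lambda>w. (B ** G w ** C) $ i $ j) 0
        = (\<Sum>l\<in>UNIV. (\<Sum>k\<in>UNIV. fls_const (B $ i $ k) * L k l) * fls_const (C $ l $ j))"
      by (intro laurent_expansion_0_eqI) (simp add: matrix_matrix_mult_def)
    moreover have "fls_prpart \<dots>
        = (\<Sum>l\<in>UNIV. smult (C $ l $ j) (\<Sum>k\<in>UNIV. smult (B $ i $ k) (fls_prpart (L k l))))"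
      by (rule poly_eqI) (simp add: coeff_sum fls_nth_sum mult.commute)
    ultimately show ?thesis
      by (simp add: poly_sum mult.commute)
  qed
  then show ?thesis
    by (simp add: vec_eq_iff principal_part_nth matrix_matrix_mult_def L_def)
qed

lemma regular_part_mult_const:
  fixes B C :: "complex^'m::finite^'m"
  assumes "matrix_pole q G U"
  shows "regular_part (\<lambda>z. B ** G z ** C) z = B ** regular_part G z ** C"
proof (cases "z = 0")
  case False
  then show ?thesis
    by (simp add: regular_part_def principal_part_mult_const[OF assms] matrix_mult_add_distribs)
next
  case True
  have lim: "(\<lambda>w. (G w - principal_part G w) $ i $ j) \<midarrow>0\<rightarrow> regular_part G 0 $ i $ j" for i j
    by (intro tendsto_vec_nth regular_part_tendsto_analytic(2)[OF assms])
  have "(\<lambda>w. B ** (G w - principal_part G w) ** C) \<midarrow>0\<rightarrow> B ** regular_part G 0 ** C"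
    unfolding matrix_matrix_mult_def
    by (intro vec_tendstoI)
      (use lim in \<open>auto intro!: tendsto_sum tendsto_mult tendsto_const\<close>)
  then show ?thesis
    using True by (simp add: regular_part_def[of "\<lambda>z. B ** G z ** C"] tendsto_Lim
        principal_part_mult_const[OF assms] matrix_mult_add_distribs)
qed

context
  fixes B C :: "complex^'m::finite^'m" and G :: "complex \<Rightarrow> complex^'m^'m" and q :: nat
  assumes inv: "C ** B = mat 1" and G: "matrix_pole q G U"
begin

text \<open>The maps to the principal and the regular part commute with constant multipliers on both
  sides. In each product of conjugated factors the inner \<open>C ** B\<close> cancels.\<close>

lemma pi_op_conjugate:
  assumes "matrix_pole k H U"
  shows "pi_op (\<lambda>z. B ** H z ** C) = (\<lambda>z. B ** pi_op H z ** C)"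
proof -
  have cancel: "(B ** X ** C) ** (B ** Y ** C) = B ** (X ** Y) ** C" for X Y
  proof -
    have "(B ** X ** C) ** (B ** Y ** C) = B ** X ** (C ** B) ** Y ** C"
      by (simp only: matrix_mul_assoc)
    then show ?thesis
      by (simp add: inv matrix_mul_assoc)
  qed
  show ?thesis
    by (rule ext) (simp only: pi_op_def regular_part_mult_const[OF assms]
        principal_part_mult_const[OF assms] cancel matrix_mult_add_distribs)
qed

lemma pi_op_funpow_conjugate:
  "(pi_op ^^ k) (\<lambda>z. B ** G z ** C) = (\<lambda>z. B ** (pi_op ^^ k) G z ** C)"
  by (induction k) (simp_all add: pi_op_conjugate[OF matrix_pole_pi_op_funpow[OF G]])

text \<open>This allows all factors of the prefactor to be estimated after conjugation by a constant
  matrix, to be chosen as \<open>E n 0\<close> below.\<close>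

lemma pi_product_conjugate:
  assumes "B ** C = mat 1"
  shows "pi_product (\<lambda>z. B ** G z ** C) k z = B ** pi_product G k z ** C"
proof (induction k)
  case 0
  show ?case
    using assms by (simp add: regular_part_mult_const[OF G] matrix_mult_add_distribs)
next
  case (Suc k)
  define X where "X = regular_part ((pi_op ^^ Suc k) G) z"
  have "B ** ((mat 1 - X) ** pi_product G k z) ** C
      = B ** (mat 1 - X) ** (C ** B) ** pi_product G k z ** C"
    by (simp add: inv matrix_mul_assoc)
  also have "\<dots> = (B ** (mat 1 - X) ** C) ** (B ** pi_product G k z ** C)"
    by (simp only: matrix_mul_assoc)
  also have "B ** (mat 1 - X) ** C = mat 1 - B ** X ** C"
    using assms by (simp add: matrix_mult_add_distribs)
  also have "B ** X ** C = regular_part ((pi_op ^^ Suc k) (\<lambda>z. B ** G z ** C)) z"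
    unfolding X_def pi_op_funpow_conjugate
    by (rule regular_part_mult_const[OF matrix_pole_pi_op_funpow[OF G], symmetric])
  finally show ?case
    by (simp only: pi_product.simps X_def Suc.IH)
qed

end

lemma pi_product_analytic:
  assumes "matrix_pole q G U"
  shows "matrix_analytic_on (pi_product G k) U"
proof (induction k)
  case 0
  have "matrix_analytic_on (\<lambda>z. mat 1 - regular_part G z) U"
    by (intro matrix_analytic_on_diff matrix_analytic_on_const regular_part_tendsto_analytic[OF assms])
  then show ?case by (simp only: pi_product.simps[abs_def])
next
  case (Suc k)
  have "matrix_analytic_on (\<lambda>z. (mat 1 - regular_part ((pi_op ^^ Suc k) G) z) ** pi_product G k z) U"
    by (intro matrix_analytic_on_mult matrix_analytic_on_diff matrix_analytic_on_const Suc
        regular_part_tendsto_analytic[OF matrix_pole_pi_op_funpow[OF assms]])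
  then show ?case by (simp only: pi_product.simps[abs_def])
qed

lemma norm_principal_part_matrix_le:
  fixes G :: "complex \<Rightarrow> complex^'m::finite^'m"
  assumes G: "matrix_pole q G U" and R: "R > 0" "cball 0 R \<subseteq> U"
    and M: "\<And>z. z \<in> sphere 0 R \<Longrightarrow> norm (G z) \<le> M" and z: "z \<in> sphere 0 R"
  shows "norm (principal_part G z) \<le> real CARD('m) * real CARD('m) * (real q * M)"
proof (rule norm_matrix_le_bound)
  fix i j
  from G obtain H where H: "matrix_analytic_on H U"
    "\<And>z. z \<in> U - {0} \<Longrightarrow> G z = mat (1 / z ^ q) ** H z"
    by (auto simp: matrix_pole_def)
  show "norm (principal_part G z $ i $ j) \<le> real q * M"
    unfolding principal_part_nth
    by (rule norm_principal_part_le[of "\<lambda>z. H z $ i $ j" U])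
      (use H U R M z in \<open>auto simp: matrix_analytic_on_def mat_mult_nth
          intro: order.trans[OF norm_matrix_entry_le]\<close>)
qed

text \<open>On the circle the regular part is \<open>G\<close> minus its principal part, and both
  are bounded there. Being analytic inside, it inherits this bound on the whole disc by the maximum
  principle.\<close>

lemma norm_regular_part_matrix_le:
  fixes G :: "complex \<Rightarrow> complex^'m::finite^'m"
  assumes G: "matrix_pole q G U" and R: "R > 0" "cball 0 R \<subseteq> U"
    and M: "\<And>z. z \<in> sphere 0 R \<Longrightarrow> norm (G z) \<le> M" and z: "z \<in> cball 0 R"
  defines "N \<equiv> real CARD('m) * real CARD('m)"
  shows "norm (regular_part G z) \<le> N * (M + N * (real q * M))"
  unfolding N_def
proof (rule matrix_analytic_le_on_cball[OF regular_part_tendsto_analytic(1)[OF G] R(2) _ z])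
  fix x :: complex assume x: "x \<in> sphere 0 R"
  then have "x \<noteq> 0" using R by auto
  then have "norm (regular_part G x) \<le> norm (G x) + norm (principal_part G x)"
    by (simp add: regular_part_def norm_triangle_ineq4)
  then show "norm (regular_part G x) \<le> M + real CARD('m) * real CARD('m) * (real q * M)"
    using M[OF x] norm_principal_part_matrix_le[OF G R M x] by linarith
qed

end

lemma matrix_pole_of_meromorphic:
  fixes C :: "complex \<Rightarrow> complex^'m::finite^'m"
  assumes C: "matrix_meromorphic_pole0 p C U" and U: "open U" "0 \<in> U"
  shows "matrix_pole p C U"
proof -
  have "\<exists>h. h analytic_on U \<and> (\<forall>z\<in>U - {0}. C z $ i $ j = h z / z ^ p)" for i j
    using C U by (intro meromorphic_bounded_pole_order) (auto simp: matrix_meromorphic_pole0_def)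
  then obtain h where h: "\<And>i j. h i j analytic_on U"
    "\<And>i j z. z \<in> U - {0} \<Longrightarrow> C z $ i $ j = h i j z / z ^ p"
    by metis
  show ?thesis
    unfolding matrix_pole_def
    by (rule exI[of _ "\<lambda>z. \<chi> i j. h i j z"])
      (use h in \<open>auto simp: matrix_analytic_on_def vec_eq_iff mat_mult_nth\<close>)
qed

section \<open>Uniform asymptotics\<close>

lemma unif_bigoI:
  assumes "\<forall>\<^sub>F n in sequentially. \<forall>x\<in>S n. norm (X n x) \<le> M * norm (g n x)"
  shows "unif_bigo S X g"
  using assms by (auto simp: unif_bigo_def)

text \<open>Replacing the constant by \<open>\<bar>M\<bar> + 1\<close> makes it positive, so that it
  can be used in monotonicity arguments and as a divisor.\<close>

lemma unif_bigoE:
  assumes "unif_bigo S X g"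
  obtains M where "M > 0" "\<forall>\<^sub>F n in sequentially. \<forall>x\<in>S n. norm (X n x) \<le> M * norm (g n x)"
proof -
  from assms obtain M where M: "\<forall>\<^sub>F n in sequentially. \<forall>x\<in>S n. norm (X n x) \<le> M * norm (g n x)"
    by (auto simp: unif_bigo_def)
  show thesis
  proof (rule that[of "\<bar>M\<bar> + 1"])
    show "\<forall>\<^sub>F n in sequentially. \<forall>x\<in>S n. norm (X n x) \<le> (\<bar>M\<bar> + 1) * norm (g n x)"
      using M
    proof eventually_elim
      case (elim n)
      have "M * norm (g n x) \<le> (\<bar>M\<bar> + 1) * norm (g n x)" for x
        by (intro mult_right_mono) auto
      with elim show ?case by (meson order.trans)
    qed
  qed simp
qed

lemma unif_bigo_trans:
  assumes "unif_bigo S X g" "unif_bigo S g h"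
  shows "unif_bigo S X h"
proof -
  from assms(1) obtain M where M: "M > 0"
    "\<forall>\<^sub>F n in sequentially. \<forall>x\<in>S n. norm (X n x) \<le> M * norm (g n x)" by (rule unif_bigoE)
  from assms(2) obtain M' where M': "M' > 0"
    "\<forall>\<^sub>F n in sequentially. \<forall>x\<in>S n. norm (g n x) \<le> M' * norm (h n x)" by (rule unif_bigoE)
  from M(2) M'(2) have "\<forall>\<^sub>F n in sequentially. \<forall>x\<in>S n. norm (X n x) \<le> (M * M') * norm (h n x)"
  proof eventually_elim
    case (elim n)
    show ?case
    proof
      fix x assume x: "x \<in> S n"
      then have "M * norm (g n x) \<le> M * (M' * norm (h n x))"
        using elim M(1) by (intro mult_left_mono) auto
      with elim x show "norm (X n x) \<le> (M * M') * norm (h n x)"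
        by (simp add: mult.assoc) (meson order.trans)
    qed
  qed
  then show ?thesis by (rule unif_bigoI)
qed

lemma unif_bigo_subset:
  assumes "unif_bigo S X g" "\<forall>\<^sub>F n in sequentially. T n \<subseteq> S n"
  shows "unif_bigo T X g"
proof -
  from assms(1) obtain M where "M > 0"
    and M: "\<forall>\<^sub>F n in sequentially. \<forall>x\<in>S n. norm (X n x) \<le> M * norm (g n x)" by (rule unif_bigoE)
  from M assms(2) have "\<forall>\<^sub>F n in sequentially. \<forall>x\<in>T n. norm (X n x) \<le> M * norm (g n x)"
    by eventually_elim auto
  then show ?thesis by (rule unif_bigoI)
qed

lemma unif_bigo_add:
  assumes "unif_bigo S X g" "unif_bigo S Y g"
  shows "unif_bigo S (\<lambda>n x. X n x + Y n x) g"
proof -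
  from assms(1) obtain M where "M > 0"
    and M: "\<forall>\<^sub>F n in sequentially. \<forall>x\<in>S n. norm (X n x) \<le> M * norm (g n x)" by (rule unif_bigoE)
  from assms(2) obtain M' where "M' > 0"
    and M': "\<forall>\<^sub>F n in sequentially. \<forall>x\<in>S n. norm (Y n x) \<le> M' * norm (g n x)" by (rule unif_bigoE)
  from M M' have "\<forall>\<^sub>F n in sequentially. \<forall>x\<in>S n. norm (X n x + Y n x) \<le> (M + M') * norm (g n x)"
    by eventually_elim (auto simp: distrib_right intro!: norm_triangle_mono)
  then show ?thesis by (rule unif_bigoI)
qed

lemma unif_bigo_uminus:
  "unif_bigo S X g \<Longrightarrow> unif_bigo S (\<lambda>n x. - X n x) g"
  by (simp add: unif_bigo_def)

lemma unif_bigo_diff: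
  assumes "unif_bigo S X g" "unif_bigo S Y g"
  shows "unif_bigo S (\<lambda>n x. X n x - Y n x) g"
  using unif_bigo_add[OF assms(1) unif_bigo_uminus[OF assms(2)]] by simp

lemma unif_bigo_const: "unif_bigo S (\<lambda>n x. c) (\<lambda>n x. 1::real)"
  by (rule unif_bigoI[of _ _ "norm c"]) simp

lemma unif_bigo_matrix_mult:
  fixes X Y :: "nat \<Rightarrow> 'i \<Rightarrow> complex^'m::finite^'m"
    and g h :: "nat \<Rightarrow> 'i \<Rightarrow> 'b::real_normed_div_algebra"
  assumes "unif_bigo S X g" "unif_bigo S Y h"
  shows "unif_bigo S (\<lambda>n x. X n x ** Y n x) (\<lambda>n x. g n x * h n x)"
proof -
  from assms(1) obtain M where M: "M > 0"
    "\<forall>\<^sub>F n in sequentially. \<forall>x\<in>S n. norm (X n x) \<le> M * norm (g n x)" by (rule unif_bigoE)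
  from assms(2) obtain M' where M': "M' > 0"
    "\<forall>\<^sub>F n in sequentially. \<forall>x\<in>S n. norm (Y n x) \<le> M' * norm (h n x)" by (rule unif_bigoE)
  from M(2) M'(2)
  have "\<forall>\<^sub>F n in sequentially. \<forall>x\<in>S n. norm (X n x ** Y n x) \<le> (M * M') * norm (g n x * h n x)"
  proof eventually_elim
    case (elim n)
    show ?case
    proof
      fix x assume x: "x \<in> S n"
      have "norm (X n x ** Y n x) \<le> norm (X n x) * norm (Y n x)"
        by (rule norm_matrix_mult_le)
      also have "\<dots> \<le> (M * norm (g n x)) * (M' * norm (h n x))"
        using elim x M(1) by (intro mult_mono) auto
      finally show "norm (X n x ** Y n x) \<le> (M * M') * norm (g n x * h n x)"
        by (simp add: norm_mult mult_ac)
    qed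
  qed
  then show ?thesis by (rule unif_bigoI)
qed

text \<open>With a bounded second factor the order of the first survives. In particular a product of
  two terms of order \<open>\<delta>\<close> is still of order \<open>\<delta>\<close>.\<close>

lemma unif_bigo_matrix_mult_bounded:
  fixes X Y :: "nat \<Rightarrow> 'i \<Rightarrow> complex^'m::finite^'m" and g h :: "nat \<Rightarrow> 'i \<Rightarrow> real"
  assumes "unif_bigo S X g" "unif_bigo S Y h" "unif_bigo S h (\<lambda>n x. 1::real)"
  shows "unif_bigo S (\<lambda>n x. X n x ** Y n x) g"
  using unif_bigo_matrix_mult[OF assms(1) unif_bigo_trans[OF assms(2,3)]] by simp

section \<open>Estimates of order delta on circles and discs varying with n\<close>

context
  fixes U :: "nat \<Rightarrow> complex set" and R \<delta> :: "nat \<Rightarrow> real"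
  assumes U: "\<forall>\<^sub>F n in sequentially. open (U n) \<and> 0 < R n \<and> cball 0 (R n) \<subseteq> U n"
    and \<delta>: "\<forall>\<^sub>F n in sequentially. \<bar>\<delta> n\<bar> \<le> 1"
begin

text \<open>The constants in the bounds for fixed \<open>n\<close> depend only on the matrix size,
  on \<open>q\<close> and on the constant for \<open>G\<close>. They contain neither
  \<open>n\<close> nor the radius, which gives uniformity.\<close>

lemma unif_bigo_parts:
  fixes G :: "nat \<Rightarrow> complex \<Rightarrow> complex^'m::finite^'m"
  assumes G: "\<forall>\<^sub>F n in sequentially. matrix_pole q (G n) (U n)"
    and bound: "unif_bigo (\<lambda>n. sphere 0 (R n)) G (\<lambda>n z. \<delta> n)"
  shows "unif_bigo (\<lambda>n. cball 0 (R n)) (\<lambda>n. regular_part (G n)) (\<lambda>n z. \<delta> n)"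
    and "unif_bigo (\<lambda>n. sphere 0 (R n)) (\<lambda>n. principal_part (G n)) (\<lambda>n z. \<delta> n)"
proof -
  define N where "N = real CARD('m) * real CARD('m)"
  from bound obtain M where "M > 0"
    and M: "\<forall>\<^sub>F n in sequentially. \<forall>x\<in>sphere 0 (R n). norm (G n x) \<le> M * norm (\<delta> n)"
    by (rule unif_bigoE)
  from U G M have "\<forall>\<^sub>F n in sequentially. \<forall>z\<in>cball 0 (R n).
      norm (regular_part (G n) z) \<le> (N * (M + N * (real q * M))) * norm (\<delta> n)"
  proof eventually_elim
    case (elim n)
    then have "norm (regular_part (G n) z)
        \<le> N * (M * norm (\<delta> n) + N * (real q * (M * norm (\<delta> n))))" if "z \<in> cball 0 (R n)" for z
      unfolding N_def by (intro norm_regular_part_matrix_le[of "U n"]) (use that in auto)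
    then show ?case
      by (simp add: algebra_simps)
  qed
  then show "unif_bigo (\<lambda>n. cball 0 (R n)) (\<lambda>n. regular_part (G n)) (\<lambda>n z. \<delta> n)"
    by (rule unif_bigoI)
  from U G M have "\<forall>\<^sub>F n in sequentially. \<forall>z\<in>sphere 0 (R n).
      norm (principal_part (G n) z) \<le> (N * (real q * M)) * norm (\<delta> n)"
  proof eventually_elim
    case (elim n)
    then have "norm (principal_part (G n) z) \<le> N * (real q * (M * norm (\<delta> n)))"
      if "z \<in> sphere 0 (R n)" for z
      unfolding N_def by (intro norm_principal_part_matrix_le[of "U n"]) (use that in auto)
    then show ?case
      by (simp add: mult.assoc)
  qed
  then show "unif_bigo (\<lambda>n. sphere 0 (R n)) (\<lambda>n. principal_part (G n)) (\<lambda>n z. \<delta> n)"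
    by (rule unif_bigoI)
qed

lemma unif_bigo_delta_1: "unif_bigo S (\<lambda>n z. \<delta> n) (\<lambda>n x. 1::real)"
  by (rule unif_bigoI[of _ _ 1], use \<delta> in eventually_elim) auto

text \<open>Every term of \<open>pi_op\<close> is a product of factors of order
  \<open>\<delta>\<close>; one of them supplies the bound and the others are merely bounded.\<close>

lemma unif_bigo_pi_op:
  fixes G :: "nat \<Rightarrow> complex \<Rightarrow> complex^'m::finite^'m"
  assumes G: "\<forall>\<^sub>F n in sequentially. matrix_pole q (G n) (U n)"
    and bound: "unif_bigo (\<lambda>n. sphere 0 (R n)) G (\<lambda>n z. \<delta> n)"
  shows "unif_bigo (\<lambda>n. sphere 0 (R n)) (\<lambda>n. pi_op (G n)) (\<lambda>n z. \<delta> n)"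
proof -
  note mult = unif_bigo_matrix_mult_bounded[OF _ _ unif_bigo_delta_1]
  have reg: "unif_bigo (\<lambda>n. sphere 0 (R n)) (\<lambda>n. regular_part (G n)) (\<lambda>n z. \<delta> n)"
    by (rule unif_bigo_subset[OF unif_bigo_parts(1)[OF assms]]) auto
  note prin = unif_bigo_parts(2)[OF assms]
  show ?thesis
    unfolding pi_op_def[abs_def]
    by (intro unif_bigo_add unif_bigo_diff unif_bigo_uminus mult reg prin bound)
qed

lemma matrix_pole_pi_op_funpow_eventually:
  assumes "\<forall>\<^sub>F n in sequentially. matrix_pole q (G n) (U n)"
  shows "\<forall>\<^sub>F n in sequentially. matrix_pole (2 ^ k * q) ((pi_op ^^ k) (G n)) (U n)"
  using U assms
proof eventually_elim
  case (elim n)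
  then have "0 \<in> U n" by auto
  with elim show ?case
    by (intro matrix_pole_pi_op_funpow) auto
qed

lemma unif_bigo_pi_op_funpow:
  fixes G :: "nat \<Rightarrow> complex \<Rightarrow> complex^'m::finite^'m"
  assumes G: "\<forall>\<^sub>F n in sequentially. matrix_pole q (G n) (U n)"
    and bound: "unif_bigo (\<lambda>n. sphere 0 (R n)) G (\<lambda>n z. \<delta> n)"
  shows "unif_bigo (\<lambda>n. sphere 0 (R n)) (\<lambda>n. (pi_op ^^ k) (G n)) (\<lambda>n z. \<delta> n)"
proof (induction k)
  case (Suc k)
  from unif_bigo_pi_op[OF matrix_pole_pi_op_funpow_eventually[OF G] Suc]
  show ?case by simp
qed (simp add: bound)

lemma unif_bigo_pi_product:
  fixes G :: "nat \<Rightarrow> complex \<Rightarrow> complex^'m::finite^'m"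
  assumes G: "\<forall>\<^sub>F n in sequentially. matrix_pole q (G n) (U n)"
    and bound: "unif_bigo (\<lambda>n. sphere 0 (R n)) G (\<lambda>n z. \<delta> n)"
  shows "unif_bigo (\<lambda>n. cball 0 (R n)) (\<lambda>n z. pi_product (G n) k z - mat 1) (\<lambda>n z. \<delta> n)"
proof (induction k)
  case 0
  show ?case
    using unif_bigo_uminus[OF unif_bigo_parts(1)[OF G bound]] by simp
next
  case (Suc k)
  define X where "X = (\<lambda>n. regular_part ((pi_op ^^ Suc k) (G n)))"
  have X: "unif_bigo (\<lambda>n. cball 0 (R n)) X (\<lambda>n z. \<delta> n)"
    unfolding X_def
    by (rule unif_bigo_parts(1)[OF matrix_pole_pi_op_funpow_eventually[OF G]
          unif_bigo_pi_op_funpow[OF G bound]])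
  \<comment> \<open>Expansion of \<open>(1 - X) P - 1\<close> with \<open>P = 1 + (P - 1)\<close>,
    where \<open>P\<close> is the product built so far: each summand is of order
    \<open>\<delta>\<close>.\<close>
  have "unif_bigo (\<lambda>n. cball 0 (R n))
      (\<lambda>n z. (pi_product (G n) k z - mat 1) - X n z - X n z ** (pi_product (G n) k z - mat 1)) (\<lambda>n z. \<delta> n)"
    by (intro unif_bigo_diff Suc X unif_bigo_matrix_mult_bounded[OF _ _ unif_bigo_delta_1])
  also have "(\<lambda>n z. (pi_product (G n) k z - mat 1) - X n z - X n z ** (pi_product (G n) k z - mat 1))
      = (\<lambda>n z. pi_product (G n) (Suc k) z - mat 1)"
    by (simp add: fun_eq_iff X_def matrix_mult_add_distribs)
  finally show ?case .
qed

end

text \<open>The expression \<open>Q n z w\<close> vanishes for \<open>z = w\<close>. First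
  \<open>z\<close> moves into the disc while \<open>w\<close> stays on the circle; then
  \<open>z\<close> is held fixed in the disc and \<open>w\<close> moves inside. Each application of
  the linear maximum principle costs a factor \<open>N\<close>.\<close>

lemma unif_bigo_quotient_on_cball:
  fixes E :: "nat \<Rightarrow> complex \<Rightarrow> complex^'m::finite^'m" and s R :: "nat \<Rightarrow> real"
  assumes U: "\<forall>\<^sub>F n in sequentially. open (U n) \<and> cball 0 (R n) \<subseteq> U n"
    and E: "\<forall>\<^sub>F n in sequentially. matrix_analytic_on (E n) (U n) \<and> (\<forall>z\<in>U n. invertible (E n z))"
    and bound: "unif_bigo (\<lambda>n. sphere 0 (R n) \<times> sphere 0 (R n))
         (\<lambda>n (z, w). matrix_inv (E n z) ** E n w - mat 1) (\<lambda>n (z, w). of_real (s n) * (z - w))"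
  shows "unif_bigo (\<lambda>n. cball 0 (R n) \<times> cball 0 (R n))
         (\<lambda>n (z, w). matrix_inv (E n z) ** E n w - mat 1) (\<lambda>n (z, w). of_real (s n) * (z - w))"
proof -
  define N where "N = real CARD('m) * real CARD('m)"
  define Q where "Q = (\<lambda>n z w. matrix_inv (E n z) ** E n w - mat 1)"
  from bound obtain M where "M > 0" and M: "\<forall>\<^sub>F n in sequentially.
      \<forall>x\<in>sphere 0 (R n) \<times> sphere 0 (R n). norm (case x of (z, w) \<Rightarrow> Q n z w)
        \<le> M * norm (case x of (z, w) \<Rightarrow> of_real (s n) * (z - w))"
    unfolding Q_def by (rule unif_bigoE)
  from U E M have "\<forall>\<^sub>F n in sequentially. \<forall>x\<in>cball 0 (R n) \<times> cball 0 (R n).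
      norm (case x of (z, w) \<Rightarrow> Q n z w)
        \<le> (N * N * M) * norm (case x of (z, w) \<Rightarrow> of_real (s n) * (z - w))"
  proof eventually_elim
    case (elim n)
    have inv: "invertible (E n z)" if "z \<in> cball 0 (R n)" for z
      using elim that by auto
    have Q0: "Q n z z = 0" if "z \<in> cball 0 (R n)" for z
      by (simp add: Q_def matrix_inv_inverse[OF inv[OF that]])
    have 1: "matrix_analytic_on (\<lambda>z. Q n z w) (U n)" for w
      unfolding Q_def using elim
      by (intro matrix_analytic_on_diff matrix_analytic_on_mult matrix_analytic_on_matrix_inv
          matrix_analytic_on_const) auto
    have 2: "matrix_analytic_on (Q n z) (U n)" for z
      unfolding Q_def using elim
      by (intro matrix_analytic_on_diff matrix_analytic_on_mult matrix_analytic_on_const) auto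
    have *: "norm (Q n z w) \<le> N * ((M * \<bar>s n\<bar>) * norm (z - w))"
      if z: "z \<in> cball 0 (R n)" and w: "w \<in> sphere 0 (R n)" for z w
      unfolding N_def
    proof (rule matrix_analytic_le_linear_on_cball[OF 1])
      show "norm (Q n x w) \<le> (M * \<bar>s n\<bar>) * norm (x - w)" if "x \<in> sphere 0 (R n)" for x
        using elim that w by (auto simp: norm_mult mult.assoc)
    qed (use elim z w Q0 in auto)
    have "norm (Q n z w) \<le> N * ((N * (M * \<bar>s n\<bar>)) * norm (w - z))"
      if z: "z \<in> cball 0 (R n)" and w: "w \<in> cball 0 (R n)" for z w
      unfolding N_def
    proof (rule matrix_analytic_le_linear_on_cball[OF 2])
      show "norm (Q n z x) \<le> real CARD('m) * real CARD('m) * (M * \<bar>s n\<bar>) * norm (x - z)"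
        if "x \<in> sphere 0 (R n)" for x
        using *[OF z that] by (simp add: N_def norm_minus_commute mult.assoc)
    qed (use elim z w Q0 in auto)
    then show ?case
      by (auto simp: norm_mult norm_minus_commute mult_ac)
  qed
  then have "unif_bigo (\<lambda>n. cball 0 (R n) \<times> cball 0 (R n)) (\<lambda>n (z, w). Q n z w)
      (\<lambda>n (z, w). of_real (s n) * (z - w))"
    by (rule unif_bigoI)
  then show ?thesis
    by (simp add: Q_def)
qed

text \<open>The unsimplified sum lists the factors of \<open>F\<close>: 1 for the scalar
  \<open>1 / z\<close>, then 0, \<open>p\<close>, 0 for \<open>E\<close>, \<open>C\<close> and the
  inverse of \<open>E\<close>. In this shape the product rule applies directly.\<close>

lemma matrix_pole_F_fun:
  fixes C E :: "nat \<Rightarrow> complex \<Rightarrow> complex^'m::finite^'m"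
  assumes E: "matrix_analytic_on (E n) U" "\<And>z. z \<in> U \<Longrightarrow> invertible (E n z)" "open U"
    and C: "matrix_pole p (C n) U" and n: "n \<ge> 1"
  shows "matrix_pole (1 + (0 + p + 0)) (F_fun b C E n) U"
proof -
  have "matrix_pole 1 (\<lambda>z. mat (1 / (of_real (real n powr b) * z)) :: complex^'m^'m) U"
    unfolding matrix_pole_def
  proof (intro exI[of _ "\<lambda>z. mat (1 / of_real (real n powr b))"] conjI ballI)
    show "mat (1 / (of_real (real n powr b) * z))
        = mat (1 / z ^ 1) ** (mat (1 / of_real (real n powr b)) :: complex^'m^'m)" for z :: complex
      by (simp add: vec_eq_iff mat_mult_nth) (simp add: mat_def)
  qed simp
  then show ?thesis
    unfolding F_fun_def[abs_def]
    by (intro matrix_pole_mult C matrix_pole_0 matrix_analytic_on_matrix_inv E)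
qed

theorem lemma3p3:
  fixes r a b c d e :: real
    and p :: nat
    and U :: "nat \<Rightarrow> complex set"
    and P N C E :: "nat \<Rightarrow> complex \<Rightarrow> complex^'m::finite^'m"
  assumes "r > 0" and "a = 0 \<longrightarrow> r > 1"
    and "a \<ge> 0" and "b \<ge> 0" and "c \<ge> 0" and "d \<ge> 0" and "e \<ge> 0"
    and "a \<le> e" and "e < b" and "d < min b c" and "c > b - a"
    and nbhd: "\<And>n. n \<ge> 1 \<Longrightarrow> open (U n) \<and> cball 0 r \<subseteq> U n"
    and N_inv: "\<forall>\<^sub>F n in sequentially. \<forall>z\<in>sphere 0 (real n powr (- a)). invertible (N n z)"
    and matching:
      "unif_bigo (\<lambda>n. sphere 0 (real n powr (- a)))
         (\<lambda>n z. P n z ** matrix_inv (N n z) ** E n z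
                - (mat 1 + mat (1 / (of_real (real n powr b) * z)) ** C n z))
         (\<lambda>n z. real n powr (- c))"
    and C_mero: "\<And>n. n \<ge> 1 \<Longrightarrow> matrix_meromorphic_pole0 p (C n) (U n)"
    and C_bdd: "unif_bigo (\<lambda>n. sphere 0 (real n powr (- a))) C (\<lambda>n z. 1::real)"
    and E_analytic: "\<And>n. n \<ge> 1 \<Longrightarrow> matrix_analytic_on (E n) (U n)"
    and E_nonsing: "\<And>n z. n \<ge> 1 \<Longrightarrow> z \<in> U n \<Longrightarrow> invertible (E n z)"
    and E_bound:
      "unif_bigo (\<lambda>n. sphere 0 (real n powr (- a))) E (\<lambda>n z. real n powr (d / 2))"
    and E_inv_bound:
      "unif_bigo (\<lambda>n. sphere 0 (real n powr (- a))) (\<lambda>n z. matrix_inv (E n z))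
         (\<lambda>n z. real n powr (d / 2))"
    and E_quot:
      "unif_bigo (\<lambda>n. sphere 0 (real n powr (- a)) \<times> sphere 0 (real n powr (- a)))
         (\<lambda>n (z, w). matrix_inv (E n z) ** E n w - mat 1)
         (\<lambda>n (z, w). of_real (real n powr e) * (z - w))"
    and C_bdd_e: "unif_bigo (\<lambda>n. sphere 0 (real n powr (- e))) C (\<lambda>n z. 1::real)"
  defines "E0 \<equiv> prefactor a b c e C E"
  shows "(\<forall>\<^sub>F n in sequentially. \<forall>z\<in>cball 0 (real n powr (- e)). invertible (E0 n z))
    \<and> (\<exists>X Y :: nat \<Rightarrow> complex \<Rightarrow> complex^'m^'m.
          unif_bigo (\<lambda>n. cball 0 (real n powr (- e))) X (\<lambda>n z. real n powr (e - b))
        \<and> unif_bigo (\<lambda>n. cball 0 (real n powr (- e))) Y (\<lambda>n z. of_real (real n powr e) * z)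
        \<and> (\<forall>\<^sub>F n in sequentially. \<forall>z\<in>cball 0 (real n powr (- e)).
              E0 n z = E n 0 ** (mat 1 + X n z + Y n z)))
    \<and> (\<exists>X Y :: nat \<Rightarrow> complex \<Rightarrow> complex^'m^'m.
          unif_bigo (\<lambda>n. cball 0 (real n powr (- e))) X (\<lambda>n z. real n powr (e - b))
        \<and> unif_bigo (\<lambda>n. cball 0 (real n powr (- e))) Y (\<lambda>n z. of_real (real n powr e) * z)
        \<and> (\<forall>\<^sub>F n in sequentially. \<forall>z\<in>cball 0 (real n powr (- e)).
              matrix_inv (E0 n z) = (mat 1 + X n z + Y n z) ** matrix_inv (E n 0)))
    \<and> (\<forall>\<rho>. 0 < \<rho> \<and> \<rho> < 1 \<longrightarrow>
          unif_bigo (\<lambda>n. cball 0 ((real n powr (- e)) * \<rho>) \<times> cball 0 ((real n powr (- e)) * \<rho>))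
            (\<lambda>n (z, w). matrix_inv (E0 n z) ** E0 n w - mat 1)
            (\<lambda>n (z, w). of_real (real n powr e) * (z - w)))"
proof -
  define R where "R = (\<lambda>n. real n powr (- e))"
  define \<delta> where "\<delta> = (\<lambda>n. real n powr (e - b))"
  define D where "D = (\<lambda>n. cball (0::complex) (R n))"
  define K where "K = K_exp a b c e"
  \<comment> \<open>With these abbreviations the prefactor is \<open>E n 0 ** Q n z ** V n z\<close>
    on the disc, and its inverse is \<open>W n z ** matrix_inv (Q n z) ** matrix_inv (E n 0)\<close>
    for large \<open>n\<close>.\<close>
  define V where "V = (\<lambda>n z. matrix_inv (E n 0) ** E n z)"
  define W where "W = (\<lambda>n z. matrix_inv (E n z) ** E n 0)"
  define F where "F = (\<lambda>n z. matrix_inv (E n 0) ** F_fun b C E n z ** E n 0)"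
  define Q where "Q = (\<lambda>n. pi_product (F n) K)"

  \<comment> \<open>Eventual inclusions of the discs\<close>
  have tends_0: "((\<lambda>n. real n powr (- s)) \<longlonglongrightarrow> 0)" if "s > 0" for s :: real
    using that by (intro tendsto_neg_powr filterlim_real_sequentially) simp
  \<comment> \<open>For \<open>a = 0\<close> the radius is 1 and does not shrink; this is the case
    in which \<open>r > 1\<close> is assumed.\<close>
  have "\<forall>\<^sub>F n in sequentially. real n powr (- a) \<le> r"
  proof (cases "a = 0")
    case True
    then have "r > 1" using assms by simp
    with True show ?thesis
      by (intro eventually_mono[OF eventually_gt_at_top[of 0]]) simp
  next
    case False
    then have "\<forall>\<^sub>F n in sequentially. real n powr (- a) < r"
      using assms by (intro order_tendstoD(2)[OF tends_0]) auto
    then show ?thesis by eventually_elim simp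
  qed
  then have ev: "\<forall>\<^sub>F n in sequentially. n \<ge> 1 \<and> open (U n) \<and> 0 \<in> U n \<and> cball 0 (real n powr (- a)) \<subseteq> U n
      \<and> 0 < R n \<and> R n \<le> real n powr (- a) \<and> D n \<subseteq> U n"
    using eventually_ge_at_top[of 1]
  proof eventually_elim
    case (elim n)
    have "R n \<le> real n powr (- a)"
      unfolding R_def using elim \<open>a \<le> e\<close> by (intro powr_mono) auto
    moreover have "cball 0 (real n powr (- a)) \<subseteq> U n" "0 \<in> U n"
      using nbhd[of n] elim \<open>r > 0\<close> by auto
    ultimately show ?case
      using nbhd[of n] elim by (auto simp: D_def R_def)
  qed
  have \<delta>_1: "\<forall>\<^sub>F n in sequentially. \<bar>\<delta> n\<bar> \<le> 1"
    using ev
  proof eventually_elim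
    case (elim n)
    then have "real n powr (e - b) \<le> real n powr 0"
      using \<open>e < b\<close> by (intro powr_mono) auto
    with elim show ?case by (simp add: \<delta>_def)
  qed
  have U: "\<forall>\<^sub>F n in sequentially. open (U n) \<and> 0 < R n \<and> cball 0 (R n) \<subseteq> U n"
    using ev by eventually_elim (simp add: D_def)
  have E_an: "\<forall>\<^sub>F n in sequentially. matrix_analytic_on (E n) (U n) \<and> (\<forall>z\<in>U n. invertible (E n z))"
    using ev by eventually_elim (simp add: E_analytic E_nonsing)

  \<comment> \<open>Comparison of E(z) with E(0)\<close>
  have quot: "unif_bigo (\<lambda>n. D n \<times> D n)
      (\<lambda>n (z, w). matrix_inv (E n z) ** E n w - mat 1) (\<lambda>n (z, w). of_real (real n powr e) * (z - w))"
    \<comment> \<open>The extension takes place on the larger disc of radius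
      \<open>real n powr (- a)\<close>, on whose circle the hypothesis holds. It is then restricted
      to \<open>D n\<close>.\<close>
    by (rule unif_bigo_subset[OF unif_bigo_quotient_on_cball[OF _ E_an E_quot]])
      (use ev in \<open>eventually_elim, auto simp: D_def\<close>)+
  have V: "unif_bigo D (\<lambda>n z. V n z - mat 1) (\<lambda>n z. of_real (real n powr e) * z)"
    and W: "unif_bigo D (\<lambda>n z. W n z - mat 1) (\<lambda>n z. of_real (real n powr e) * z)"
  proof -
    from quot obtain M where "\<forall>\<^sub>F n in sequentially. \<forall>x\<in>D n \<times> D n.
        norm (case x of (z, w) \<Rightarrow> matrix_inv (E n z) ** E n w - mat 1)
        \<le> M * norm (case x of (z, w) \<Rightarrow> complex_of_real (real n powr e) * (z - w))"
      by (rule unif_bigoE)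
    then have *: "\<forall>\<^sub>F n in sequentially. (\<forall>z\<in>D n. norm (V n z - mat 1) \<le> M * norm (complex_of_real (real n powr e) * z))
       \<and> (\<forall>z\<in>D n. norm (W n z - mat 1) \<le> M * norm (complex_of_real (real n powr e) * z))"
      using ev
    proof eventually_elim
      case (elim n)
      then have "0 \<in> D n" by (simp add: D_def)
      then show ?case
        \<comment> \<open>The pair \<open>(0, z)\<close> gives \<open>V\<close>, and the pair
          \<open>(z, 0)\<close> gives \<open>W\<close>.\<close>
        using elim(1) by (force simp: V_def W_def norm_mult)
    qed
    show "unif_bigo D (\<lambda>n z. V n z - mat 1) (\<lambda>n z. of_real (real n powr e) * z)"
      "unif_bigo D (\<lambda>n z. W n z - mat 1) (\<lambda>n z. of_real (real n powr e) * z)"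
      using * by (auto intro!: unif_bigoI[of _ _ M] elim: eventually_mono)
  qed
  \<comment> \<open>The radius of \<open>D n\<close> is exactly the scale on which
    \<open>real n powr e * norm z\<close> stays at most 1. Hence \<open>V\<close> and
    \<open>W\<close> are bounded.\<close>
  have disc_1: "unif_bigo D (\<lambda>n z. complex_of_real (real n powr e) * z) (\<lambda>n z. 1::real)"
  proof (rule unif_bigoI[of _ _ 1])
    show "\<forall>\<^sub>F n in sequentially. \<forall>z\<in>D n. norm (complex_of_real (real n powr e) * z) \<le> 1 * norm (1::real)"
      using ev
    proof eventually_elim
      case (elim n)
      have "real n powr e * norm z \<le> real n powr e * R n" if "z \<in> D n" for z
        using that by (intro mult_left_mono) (auto simp: D_def)
      also have "real n powr e * R n = 1"
        using elim by (simp add: R_def powr_minus field_simps)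
      finally show ?case by (simp add: norm_mult)
    qed
  qed
  have V_1: "unif_bigo D V (\<lambda>n z. 1::real)"
    using unif_bigo_add[OF unif_bigo_trans[OF V disc_1] unif_bigo_const[of _ "mat 1"]] by simp
  have W_1: "unif_bigo D W (\<lambda>n z. 1::real)"
    using unif_bigo_add[OF unif_bigo_trans[OF W disc_1] unif_bigo_const[of _ "mat 1"]] by simp

  \<comment> \<open>The conjugated function F and the product of its factors\<close>
  have F_pole0: "\<forall>\<^sub>F n in sequentially. matrix_pole (1 + (0 + p + 0)) (F_fun b C E n) (U n)"
    using ev
    by eventually_elim
      (intro matrix_pole_F_fun matrix_pole_of_meromorphic E_analytic E_nonsing C_mero, auto)
  then have F_pole: "\<forall>\<^sub>F n in sequentially. matrix_pole (0 + (1 + (0 + p + 0)) + 0) (F n) (U n)"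
    unfolding F_def
    by eventually_elim (intro matrix_pole_mult matrix_pole_0 matrix_analytic_on_const)
  have F_bound: "unif_bigo (\<lambda>n. sphere 0 (R n)) F (\<lambda>n z. \<delta> n)"
  proof -
    define m where "m = (\<lambda>n z. mat (1 / (of_real (real n powr b) * z)) :: complex^'m^'m)"
    have sub: "\<forall>\<^sub>F n in sequentially. sphere 0 (R n) \<subseteq> D n"
      by (auto simp: D_def)
    \<comment> \<open>Conjugation by \<open>E n 0\<close> turns the outer factors into
      \<open>V\<close> and \<open>W\<close>, which are bounded. The size of \<open>F\<close> is then
      governed by the scalar factor \<open>m\<close>, which has modulus \<open>\<delta> n\<close> on
      the circle.\<close>
    have F_eq: "F = (\<lambda>n z. m n z ** (V n z ** C n z ** W n z))"
    proof (intro ext)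
      fix n z
      have "F n z = matrix_inv (E n 0) ** m n z ** (E n z ** C n z ** matrix_inv (E n z)) ** E n 0"
        by (simp only: F_def F_fun_def m_def matrix_mul_assoc)
      also have "matrix_inv (E n 0) ** m n z = m n z ** matrix_inv (E n 0)"
        unfolding m_def by (rule mat_mult_commute)
      finally show "F n z = m n z ** (V n z ** C n z ** W n z)"
        by (simp only: V_def W_def matrix_mul_assoc)
    qed
    have m: "unif_bigo (\<lambda>n. sphere 0 (R n)) m (\<lambda>n z. \<delta> n)"
    proof (rule unif_bigoI[of _ _ "real CARD('m) * real CARD('m)"])
      show "\<forall>\<^sub>F n in sequentially. \<forall>z\<in>sphere 0 (R n). norm (m n z) \<le> real CARD('m) * real CARD('m) * norm (\<delta> n)"
        using ev
      proof (eventually_elim, intro ballI norm_matrix_le_bound)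
        fix n :: nat and z :: complex and i j :: 'm
        assume n: "n \<ge> 1 \<and> open (U n) \<and> 0 \<in> U n \<and> cball 0 (real n powr (- a)) \<subseteq> U n
            \<and> 0 < R n \<and> R n \<le> real n powr (- a) \<and> D n \<subseteq> U n"
          and z: "z \<in> sphere 0 (R n)"
        have "norm (1 / (complex_of_real (real n powr b) * z)) = \<delta> n"
          using z by (simp add: norm_divide norm_mult R_def \<delta>_def powr_diff powr_minus_divide)
        then show "norm (m n z $ i $ j) \<le> norm (\<delta> n)"
          by (simp add: m_def mat_def abs_ge_self)
      qed
    qed
    have C': "unif_bigo (\<lambda>n. sphere 0 (R n)) C (\<lambda>n z. 1::real)"
      using C_bdd_e by (simp add: R_def)
    have one: "unif_bigo S (\<lambda>n z. 1::real) (\<lambda>n z. 1::real)" for S :: "nat \<Rightarrow> complex set"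
      by (rule unif_bigo_const)
    show ?thesis
      unfolding F_eq
      by (intro unif_bigo_matrix_mult_bounded[OF _ _ one] m C'
          unif_bigo_subset[OF V_1 sub] unif_bigo_subset[OF W_1 sub])
  qed
  \<comment> \<open>The number of factors is fixed while \<open>n\<close> grows, so the constants
    accumulate only finitely often.\<close>
  have Q: "unif_bigo D (\<lambda>n z. Q n z - mat 1) (\<lambda>n z. \<delta> n)"
    unfolding Q_def D_def by (rule unif_bigo_pi_product[OF U \<delta>_1 F_pole F_bound])

  have E0_eq: "\<forall>\<^sub>F n in sequentially. \<forall>z\<in>D n. E0 n z = E n 0 ** Q n z ** V n z"
    using ev F_pole0
  proof (eventually_elim, intro ballI)
    fix n z
    assume n: "n \<ge> 1 \<and> open (U n) \<and> 0 \<in> U n \<and> cball 0 (real n powr (- a)) \<subseteq> U n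
        \<and> 0 < R n \<and> R n \<le> real n powr (- a) \<and> D n \<subseteq> U n"
      and pole: "matrix_pole (1 + (0 + p + 0)) (F_fun b C E n) (U n)"
    have inv: "invertible (E n 0)"
      using n by (auto intro: E_nonsing)
    have "Q n z = matrix_inv (E n 0) ** pi_product (F_fun b C E n) K z ** E n 0"
      unfolding Q_def F_def using n
      by (intro pi_product_conjugate[OF _ _ _ pole] matrix_inv_inverse inv) auto
    \<comment> \<open>Undoing the conjugation leaves \<open>E n 0\<close> next to its inverse on
      both sides of the product.\<close>
    then have "E n 0 ** Q n z ** V n z = (E n 0 ** matrix_inv (E n 0))
        ** pi_product (F_fun b C E n) K z ** (E n 0 ** matrix_inv (E n 0)) ** E n z"
      by (simp only: V_def matrix_mul_assoc)
    then show "E0 n z = E n 0 ** Q n z ** V n z"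
      by (simp add: matrix_inv_inverse[OF inv] E0_def prefactor_def K_def)
  qed

  \<comment> \<open>Inverses of Q and of the prefactor\<close>
  have Q_inv: "\<forall>\<^sub>F n in sequentially. \<forall>z\<in>D n. invertible (Q n z)"
    and Q_inv_bound: "unif_bigo D (\<lambda>n z. matrix_inv (Q n z) - mat 1) (\<lambda>n z. \<delta> n)"
  proof -
    from Q obtain M where "M > 0"
      and M: "\<forall>\<^sub>F n in sequentially. \<forall>z\<in>D n. norm (Q n z - mat 1) \<le> M * norm (\<delta> n)"
      by (rule unif_bigoE)
    \<comment> \<open>This threshold makes \<open>Q n z - mat 1\<close> at most 1/2 in norm, as
      needed to invert a perturbation of the identity; it is reached because
      \<open>e < b\<close>.\<close>
    have "\<forall>\<^sub>F n in sequentially. \<delta> n < 1 / (2 * M)"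
      using tends_0[of "b - e"] \<open>e < b\<close> \<open>M > 0\<close> by (intro order_tendstoD(2)) (auto simp: \<delta>_def)
    with M have small: "\<forall>\<^sub>F n in sequentially. \<forall>z\<in>D n. norm (Q n z - mat 1) \<le> 1 / 2"
    proof eventually_elim
      case (elim n)
      have "M * norm (\<delta> n) \<le> 1 / 2"
        using elim(2) \<open>M > 0\<close> by (simp add: \<delta>_def field_simps)
      with elim show ?case by fastforce
    qed
    from small show "\<forall>\<^sub>F n in sequentially. \<forall>z\<in>D n. invertible (Q n z)"
    proof (eventually_elim, intro ballI)
      fix n z
      assume "\<forall>z\<in>D n. norm (Q n z - mat 1) \<le> 1 / 2" "z \<in> D n"
      then show "invertible (Q n z)"
        using invertible_mat_1_add_small(1)[of "Q n z - mat 1"] by simp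
    qed
    have "unif_bigo D (\<lambda>n z. matrix_inv (Q n z) - mat 1) (\<lambda>n z. Q n z - mat 1)"
    proof (rule unif_bigoI)
      from small show "\<forall>\<^sub>F n in sequentially. \<forall>z\<in>D n. norm (matrix_inv (Q n z) - mat 1)
          \<le> 2 * norm (mat 1 :: complex^'m^'m) * norm (Q n z - mat 1)"
      proof (eventually_elim, intro ballI)
        fix n z
        assume "\<forall>z\<in>D n. norm (Q n z - mat 1) \<le> 1 / 2" "z \<in> D n"
        then show "norm (matrix_inv (Q n z) - mat 1)
            \<le> 2 * norm (mat 1 :: complex^'m^'m) * norm (Q n z - mat 1)"
          using invertible_mat_1_add_small(2)[of "Q n z - mat 1"] by simp
      qed
    qed
    then show "unif_bigo D (\<lambda>n z. matrix_inv (Q n z) - mat 1) (\<lambda>n z. \<delta> n)"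
      using Q by (rule unif_bigo_trans)
  qed
  have \<delta>_bigo_1: "unif_bigo D (\<lambda>n z. \<delta> n) (\<lambda>n z. 1::real)"
    by (rule unif_bigo_delta_1[OF U \<delta>_1])
  have Q_1: "unif_bigo D Q (\<lambda>n z. 1::real)"
    using unif_bigo_add[OF unif_bigo_trans[OF Q \<delta>_bigo_1] unif_bigo_const[of _ "mat 1"]] by simp
  have Q_inv_1: "unif_bigo D (\<lambda>n z. matrix_inv (Q n z)) (\<lambda>n z. 1::real)"
    using unif_bigo_add[OF unif_bigo_trans[OF Q_inv_bound \<delta>_bigo_1] unif_bigo_const[of _ "mat 1"]] by simp

  have E0_inv: "\<forall>\<^sub>F n in sequentially. \<forall>z\<in>D n. invertible (E0 n z)
      \<and> matrix_inv (E0 n z) = W n z ** matrix_inv (Q n z) ** matrix_inv (E n 0)"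
    using ev E0_eq Q_inv
  proof (eventually_elim, intro ballI)
    fix n z
    assume n: "n \<ge> 1 \<and> open (U n) \<and> 0 \<in> U n \<and> cball 0 (real n powr (- a)) \<subseteq> U n
        \<and> 0 < R n \<and> R n \<le> real n powr (- a) \<and> D n \<subseteq> U n"
      and E0: "\<forall>z\<in>D n. E0 n z = E n 0 ** Q n z ** V n z"
      and inv: "\<forall>z\<in>D n. invertible (Q n z)" and z: "z \<in> D n"
    have invE: "invertible (E n z)" "invertible (E n 0)"
      using n z by (auto intro: E_nonsing)
    have VW: "V n z ** W n z = mat 1"
    proof -
      have "V n z ** W n z = matrix_inv (E n 0) ** (E n z ** matrix_inv (E n z)) ** E n 0"
        by (simp only: V_def W_def matrix_mul_assoc)
      then show ?thesis
        by (simp add: matrix_inv_inverse invE)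
    qed
    \<comment> \<open>For square matrices a right inverse is the inverse, so one product
      suffices.\<close>
    have "E0 n z ** (W n z ** matrix_inv (Q n z) ** matrix_inv (E n 0))
        = E n 0 ** Q n z ** (V n z ** W n z) ** matrix_inv (Q n z) ** matrix_inv (E n 0)"
      using E0 z by (simp only: matrix_mul_assoc)
    also have "\<dots> = E n 0 ** (Q n z ** matrix_inv (Q n z)) ** matrix_inv (E n 0)"
      by (simp add: VW matrix_mul_assoc)
    also have "\<dots> = mat 1"
      using inv z by (simp add: matrix_inv_inverse invE)
    finally show "invertible (E0 n z)
      \<and> matrix_inv (E0 n z) = W n z ** matrix_inv (Q n z) ** matrix_inv (E n 0)"
      using matrix_inv_eqI by blast
  qed

  \<comment> \<open>The four assertions\<close>
  have concl1: "\<forall>\<^sub>F n in sequentially. \<forall>z\<in>cball 0 (real n powr (- e)). invertible (E0 n z)"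
    using E0_inv by eventually_elim (simp add: D_def R_def)
  have concl2: "\<exists>X Y :: nat \<Rightarrow> complex \<Rightarrow> complex^'m^'m.
          unif_bigo (\<lambda>n. cball 0 (real n powr (- e))) X (\<lambda>n z. real n powr (e - b))
        \<and> unif_bigo (\<lambda>n. cball 0 (real n powr (- e))) Y (\<lambda>n z. of_real (real n powr e) * z)
        \<and> (\<forall>\<^sub>F n in sequentially. \<forall>z\<in>cball 0 (real n powr (- e)).
              E0 n z = E n 0 ** (mat 1 + X n z + Y n z))"
  proof (intro exI conjI)
    \<comment> \<open>The witnesses split \<open>Q V\<close> as
      \<open>1 + (Q - 1) V + (V - 1)\<close>: the first error comes from the product of factors, the
      second from the variation of \<open>E\<close>.\<close>
    show "unif_bigo (\<lambda>n. cball 0 (real n powr (- e))) (\<lambda>n z. (Q n z - mat 1) ** V n z)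
        (\<lambda>n z. real n powr (e - b))"
      using unif_bigo_matrix_mult[OF Q V_1] by (simp add: D_def R_def \<delta>_def)
    show "unif_bigo (\<lambda>n. cball 0 (real n powr (- e))) (\<lambda>n z. V n z - mat 1)
        (\<lambda>n z. of_real (real n powr e) * z)"
      using V by (simp add: D_def R_def)
    show "\<forall>\<^sub>F n in sequentially. \<forall>z\<in>cball 0 (real n powr (- e)).
        E0 n z = E n 0 ** (mat 1 + (Q n z - mat 1) ** V n z + (V n z - mat 1))"
      using E0_eq by eventually_elim (simp add: D_def R_def matrix_mult_add_distribs matrix_mul_assoc)
  qed
  have concl3: "\<exists>X Y :: nat \<Rightarrow> complex \<Rightarrow> complex^'m^'m.
          unif_bigo (\<lambda>n. cball 0 (real n powr (- e))) X (\<lambda>n z. real n powr (e - b))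
        \<and> unif_bigo (\<lambda>n. cball 0 (real n powr (- e))) Y (\<lambda>n z. of_real (real n powr e) * z)
        \<and> (\<forall>\<^sub>F n in sequentially. \<forall>z\<in>cball 0 (real n powr (- e)).
              matrix_inv (E0 n z) = (mat 1 + X n z + Y n z) ** matrix_inv (E n 0))"
  proof (intro exI conjI)
    \<comment> \<open>The same splitting for the inverse, with the bounded factor \<open>W\<close>
      now on the left.\<close>
    show "unif_bigo (\<lambda>n. cball 0 (real n powr (- e))) (\<lambda>n z. W n z ** (matrix_inv (Q n z) - mat 1))
        (\<lambda>n z. real n powr (e - b))"
      using unif_bigo_matrix_mult[OF W_1 Q_inv_bound] by (simp add: D_def R_def \<delta>_def)
    show "unif_bigo (\<lambda>n. cball 0 (real n powr (- e))) (\<lambda>n z. W n z - mat 1)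
        (\<lambda>n z. of_real (real n powr e) * z)"
      using W by (simp add: D_def R_def)
    show "\<forall>\<^sub>F n in sequentially. \<forall>z\<in>cball 0 (real n powr (- e)). matrix_inv (E0 n z)
        = (mat 1 + W n z ** (matrix_inv (Q n z) - mat 1) + (W n z - mat 1)) ** matrix_inv (E n 0)"
      using E0_inv by eventually_elim (simp add: D_def R_def matrix_mult_add_distribs)
  qed
  have concl4: "unif_bigo (\<lambda>n. cball 0 ((real n powr (- e)) * \<rho>) \<times> cball 0 ((real n powr (- e)) * \<rho>))
            (\<lambda>n (z, w). matrix_inv (E0 n z) ** E0 n w - mat 1)
            (\<lambda>n (z, w). of_real (real n powr e) * (z - w))"
    if \<rho>: "0 < \<rho>" "\<rho> < 1" for \<rho>
  proof -
    \<comment> \<open>\<open>H\<close> is the prefactor with \<open>E n 0\<close> removed on the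
      left, and \<open>G\<close> is its inverse on the disc for large \<open>n\<close>. Both are
      bounded, and the expression to estimate becomes \<open>G n z ** (H n w - H n z)\<close>, in
      which \<open>E n 0\<close> has cancelled.\<close>
    define H where "H = (\<lambda>n z. Q n z ** V n z)"
    define G where "G = (\<lambda>n z. W n z ** matrix_inv (Q n z))"
    define N where "N = real CARD('m) * real CARD('m)"
    have "unif_bigo D H (\<lambda>n z. 1::real)"
      unfolding H_def using unif_bigo_matrix_mult[OF Q_1 V_1] by simp
    then obtain M where M: "M > 0" "\<forall>\<^sub>F n in sequentially. \<forall>z\<in>D n. norm (H n z) \<le> M * norm (1::real)"
      by (rule unif_bigoE)
    have "unif_bigo D G (\<lambda>n z. 1::real)"
      unfolding G_def using unif_bigo_matrix_mult[OF W_1 Q_inv_1] by simp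
    then obtain M' where M': "M' > 0" "\<forall>\<^sub>F n in sequentially. \<forall>z\<in>D n. norm (G n z) \<le> M' * norm (1::real)"
      by (rule unif_bigoE)
    \<comment> \<open>In the constant, \<open>M'\<close> bounds \<open>G\<close>,
      \<open>2 * M\<close> bounds a difference of two values of \<open>H\<close>, and
      \<open>N\<close> comes from the maximum principle. The factor \<open>1 - \<rho>\<close> comes
      from the distance to the circle, whose remaining factor \<open>1 / R n\<close> is
      \<open>real n powr e\<close>.\<close>
    have "\<forall>\<^sub>F n in sequentially. \<forall>x\<in>cball 0 ((real n powr (- e)) * \<rho>) \<times> cball 0 ((real n powr (- e)) * \<rho>).
        norm (case x of (z, w) \<Rightarrow> matrix_inv (E0 n z) ** E0 n w - mat 1)
        \<le> (M' * (N * (2 * M / (1 - \<rho>)))) * norm (case x of (z, w) \<Rightarrow> complex_of_real (real n powr e) * (z - w))"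
      using ev F_pole E_an E0_eq E0_inv M(2) M'(2)
    proof (eventually_elim, intro ballI)
      fix n and x :: "complex \<times> complex"
      assume n: "n \<ge> 1 \<and> open (U n) \<and> 0 \<in> U n \<and> cball 0 (real n powr (- a)) \<subseteq> U n
          \<and> 0 < R n \<and> R n \<le> real n powr (- a) \<and> D n \<subseteq> U n"
        and pole: "matrix_pole (0 + (1 + (0 + p + 0)) + 0) (F n) (U n)"
        and E_an: "matrix_analytic_on (E n) (U n) \<and> (\<forall>z\<in>U n. invertible (E n z))"
        and E0: "\<forall>z\<in>D n. E0 n z = E n 0 ** Q n z ** V n z"
        and inv: "\<forall>z\<in>D n. invertible (E0 n z)
          \<and> matrix_inv (E0 n z) = W n z ** matrix_inv (Q n z) ** matrix_inv (E n 0)"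
        and M: "\<forall>z\<in>D n. norm (H n z) \<le> M * norm (1::real)"
        and M': "\<forall>z\<in>D n. norm (G n z) \<le> M' * norm (1::real)"
        and "x \<in> cball 0 (real n powr (- e) * \<rho>) \<times> cball 0 (real n powr (- e) * \<rho>)"
      then obtain z w where x_eq: "x = (z, w)"
        and zw: "norm z \<le> R n * \<rho>" "norm w \<le> R n * \<rho>"
        by (auto simp: R_def)
      have "R n * \<rho> \<le> R n"
        using n \<rho> by (simp add: mult_le_cancel_left1)
      with zw have zwD: "z \<in> D n" "w \<in> D n"
        by (auto simp: D_def)
      have "invertible (E0 n z)"
        using inv zwD by blast
      then have "matrix_inv (E0 n z) ** E0 n w - mat 1 = matrix_inv (E0 n z) ** (E0 n w - E0 n z)"
        by (simp add: matrix_mult_add_distribs matrix_inv_inverse)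
      also have "E0 n w - E0 n z = E n 0 ** (H n w - H n z)"
        using E0 zwD by (simp add: H_def matrix_mult_add_distribs matrix_mul_assoc)
      also have "matrix_inv (E0 n z) ** (E n 0 ** (H n w - H n z))
          = G n z ** (matrix_inv (E n 0) ** E n 0) ** (H n w - H n z)"
        using inv zwD by (simp add: G_def matrix_mul_assoc)
      also have "\<dots> = G n z ** (H n w - H n z)"
        using E_an n by (simp add: matrix_inv_inverse)
      finally have "norm (matrix_inv (E0 n z) ** E0 n w - mat 1) \<le> norm (G n z) * norm (H n w - H n z)"
        by (simp add: norm_matrix_mult_le)
      also have "\<dots> \<le> M' * (N * (2 * M / (R n * (1 - \<rho>)) * norm (w - z)))"
      proof (rule mult_mono)
        show "norm (H n w - H n z) \<le> N * (2 * M / (R n * (1 - \<rho>)) * norm (w - z))"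
          unfolding N_def
        \<comment> \<open>The function \<open>H n x - H n z\<close> of \<open>x\<close> vanishes at
          \<open>z\<close>. The linear bound is needed only on the full circle of radius
          \<open>R n\<close>, where \<open>x\<close> is at distance at least
          \<open>R n * (1 - \<rho>)\<close> from \<open>z\<close>.\<close>
        proof (rule matrix_analytic_le_linear_on_cball[of "\<lambda>x. H n x - H n z" "U n" "R n" z])
          have "matrix_analytic_on (Q n) (U n)"
            unfolding Q_def using n pole by (intro pi_product_analytic) auto
          then show "matrix_analytic_on (\<lambda>x. H n x - H n z) (U n)"
            unfolding H_def V_def
            by (intro matrix_analytic_on_diff matrix_analytic_on_mult matrix_analytic_on_const E_an[THEN conjunct1])
          show "norm (H n x - H n z) \<le> 2 * M / (R n * (1 - \<rho>)) * norm (x - z)"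
            if x: "x \<in> sphere 0 (R n)" for x
          proof -
            have "x \<in> D n"
              using x by (simp add: D_def)
            with M zwD have "norm (H n x) \<le> M" "norm (H n z) \<le> M"
              by auto
            then have "norm (H n x - H n z) \<le> 2 * M"
              using norm_triangle_ineq4[of "H n x" "H n z"] by linarith
            also have "\<dots> = 2 * M / (R n * (1 - \<rho>)) * (R n * (1 - \<rho>))"
              using n \<rho> by simp
            also have "\<dots> \<le> 2 * M / (R n * (1 - \<rho>)) * norm (x - z)"
            proof (rule mult_left_mono)
              show "R n * (1 - \<rho>) \<le> norm (x - z)"
                using x zw norm_triangle_ineq2[of x z] by (simp add: algebra_simps)
            qed (use n \<rho> \<open>M > 0\<close> in simp)
            finally show ?thesis .
          qed
        qed (use n zwD in \<open>auto simp: D_def\<close>)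
      qed (use M' zwD \<open>M' > 0\<close> in auto)
      also have "\<dots> = (M' * (N * (2 * M / (1 - \<rho>)))) * (real n powr e * norm (z - w))"
        using n \<rho> by (simp add: R_def powr_minus field_simps norm_minus_commute)
      finally show "norm (case x of (z, w) \<Rightarrow> matrix_inv (E0 n z) ** E0 n w - mat 1)
          \<le> (M' * (N * (2 * M / (1 - \<rho>))))
            * norm (case x of (z, w) \<Rightarrow> complex_of_real (real n powr e) * (z - w))"
        by (simp add: x_eq norm_mult)
    qed
    then show ?thesis
      by (rule unif_bigoI)
  qed
  show ?thesis
    using concl1 concl2 concl3 concl4 by blast
qed

end
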